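(* Let $G = G_{n,r,s}$ or $G = G^+_{n,r,s}$ be a graph in $\mathcal{G}$ with $r \le s$ and $n \ge 6$. (i) If $r=1$, the wheel $G^+_{n,1,n-3}$ has exactly $n-1$ maximal subdividable sets of edges; each consists of all edges of the rim together with exactly one spoke. (ii) If $r=2$ and either $G = G_{n,2,s}$ with $s\ge 4$ or $G = G^+_{n,2,s}$ with $s\ge 3$, then $G$ has exactly two maximal subdividable sets of edges: the edge set of the spine $v_1v_2\ldots v_n$ and the edge set of the path $v_{n-2}v_{n-3}\ldots v_2v_1v_{n-1}v_n$. (iii) If $r \ge 3$, the only maximal subdividable set of edges is the edge set of the spine $v_1v_2\ldots v_n$.
   Context: For $n \ge 3$ and $r,s \in \{0,1,\ldots,n-3\}$, the graph $G_{n,r,s}$ has vertex set $\{v_1,\ldots,v_n\}$ and consists of the path $v_1v_2\ldots v_n$ (the spine), the edges $v_1v_{n-i}$ for $1 \le i \le r$, and the edges $v_nv_{1+j}$ for $1 \le j \le s$; $G^+_{n,r,s}$ is $G_{n,r,s}$ plus the edge $v_1v_n$. $\mathcal{G}$ is the set of graphs of the form $G_{n,r,s}$ or $G^+_{n,r,s}$ that are $3$-connected and $K_{2,4}$-minor-free. $G^+_{n,1,n-3}$ is the wheel $K_1 + C_{n-1}$ with hub $v_n$; spokes are the edges at the hub and the rim is the cycle on the other vertices. If $G$ is $K_{2,4}$-minor-free, $F \subseteq E(G)$ is subdividable if the graph obtained from $G$ by subdividing each edge of $F$ once (replacing it by a path of length $2$) is $K_{2,4}$-minor-free; maximal means maximal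 under inclusion. *)

theory Defs
  imports Main
begin

(* Graphs are finite or infinite undirected graphs; an edge is the set of its two ends. *)

datatype 'v graph = Graph (verts: "'v set") (edges: "'v set set")

definition adj :: "'v graph \<Rightarrow> 'v \<Rightarrow> 'v \<Rightarrow> bool" where
  "adj G u v \<longleftrightarrow> {u, v} \<in> edges G"

definition induced :: "'v graph \<Rightarrow> 'v set \<Rightarrow> 'v graph" where
  "induced G X = Graph (verts G \<inter> X) {e \<in> edges G. e \<subseteq> X}"

definition connected_graph :: "'v graph \<Rightarrow> bool" where
  "connected_graph G \<longleftrightarrow>
     verts G \<noteq> {} \<and> (\<forall>u \<in> verts G. \<forall>v \<in> verts G. (adj G)\<^sup>*\<^sup>* u v)"

(* The bound on card also makes the vertex set finite when k_connected holds, because card is 0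
   on infinite sets. *)
definition k_connected :: "nat \<Rightarrow> 'v graph \<Rightarrow> bool" where
  "k_connected k G \<longleftrightarrow>
     k < card (verts G) \<and>
     (\<forall>X \<subseteq> verts G. card X < k \<longrightarrow> connected_graph (induced G (verts G - X)))"

(* H is a minor of G: B assigns to the vertices of H disjoint connected branch sets in G.
   Contracting them and deleting what is left over turns G into a copy of H. *)
definition is_minor :: "'w graph \<Rightarrow> 'v graph \<Rightarrow> bool" where
  "is_minor H G \<longleftrightarrow>
     (\<exists>B. (\<forall>x \<in> verts H. B x \<subseteq> verts G \<and> connected_graph (induced G (B x))) \<and>
          (\<forall>x \<in> verts H. \<forall>y \<in> verts H. x \<noteq> y \<longrightarrow> B x \<inter> B y = {}) \<and>
          (\<forall>x \<in> verts H. \<forall>y \<in> verts H. adj H x y \<longrightarrow> (\<exists>u \<in> B x. \<exists>v \<in> B y. adj G u v)))"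

definition complete_bipartite :: "nat \<Rightarrow> nat \<Rightarrow> (nat + nat) graph" where
  "complete_bipartite a b =
     Graph (Inl ` {..<a} \<union> Inr ` {..<b}) {{Inl i, Inr j} | i j. i < a \<and> j < b}"

definition K24_minor_free :: "'v graph \<Rightarrow> bool" where
  "K24_minor_free G \<longleftrightarrow> \<not> is_minor (complete_bipartite 2 4) G"

(* The edge e in F is replaced by a path of length 2 through the new vertex Inr e. *)
definition subdivide :: "'v graph \<Rightarrow> 'v set set \<Rightarrow> ('v + 'v set) graph" where
  "subdivide G F =
     Graph (Inl ` verts G \<union> Inr ` F)
           ((\<lambda>e. Inl ` e) ` (edges G - F) \<union> {{Inl x, Inr e} | x e. e \<in> F \<and> x \<in> e})"

definition subdividable :: "'v graph \<Rightarrow> 'v set set \<Rightarrow> bool" where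
  "subdividable G F \<longleftrightarrow> F \<subseteq> edges G \<and> K24_minor_free (subdivide G F)"

definition maximal_subdividable :: "'v graph \<Rightarrow> 'v set set \<Rightarrow> bool" where
  "maximal_subdividable G F \<longleftrightarrow>
     subdividable G F \<and> (\<forall>F'. subdividable G F' \<and> F \<subseteq> F' \<longrightarrow> F' = F)"

(* The edges joining consecutive entries of a list of vertices. *)
definition walk_edges :: "'v list \<Rightarrow> 'v set set" where
  "walk_edges xs = {{xs ! i, xs ! Suc i} | i. Suc i < length xs}"

(* The vertex v_i is the number i. *)

definition spine :: "nat \<Rightarrow> nat set set" where
  "spine n = walk_edges [1..<n+1]"

definition G_graph :: "nat \<Rightarrow> nat \<Rightarrow> nat \<Rightarrow> nat graph" where
  "G_graph n r s =
     Graph {1..n}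
       (spine n \<union> {{1, n - i} | i. 1 \<le> i \<and> i \<le> r} \<union> {{n, 1 + j} | j. 1 \<le> j \<and> j \<le> s})"

definition Gplus_graph :: "nat \<Rightarrow> nat \<Rightarrow> nat \<Rightarrow> nat graph" where
  "Gplus_graph n r s =
     Graph (verts (G_graph n r s)) (insert {1, n} (edges (G_graph n r s)))"

(* The parameters r and s range over {0..n-3}; the difference is not truncated as n is at least 3. *)
definition G_class :: "nat graph set" where
  "G_class =
     {G. (\<exists>n r s. 3 \<le> n \<and> r \<in> {0..n-3} \<and> s \<in> {0..n-3} \<and>
            (G = G_graph n r s \<or> G = Gplus_graph n r s)) \<and>
         k_connected 3 G \<and> K24_minor_free G}"

definition wheel :: "nat \<Rightarrow> nat graph" where
  "wheel n = Gplus_graph n 1 (n - 3)"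

(* The hub of wheel n is n. *)

definition wheel_spokes :: "nat \<Rightarrow> nat set set" where
  "wheel_spokes n = {e \<in> edges (wheel n). n \<in> e}"

definition wheel_rim :: "nat \<Rightarrow> nat set set" where
  "wheel_rim n = walk_edges ([1..<n] @ [1])"

end

(* Every claimed subdivision is a subgraph of a double
   fan: a path from lo to hi in which lo is also adjacent to all vertices from k on and hi to all
   vertices up to k. Double fans have no K24 minor: the two hubs have to contain lo and hi, and then
   at most three disjoint connected sets can touch both hubs. For the spine one takes the path of
   the graph itself; for r = 2 the second path becomes the path of a double fan after reversing
   v_1, ..., v_(n-2); for the wheel one walks around the rim starting at the end of the subdivided
   spoke.
   Conversely, if hubs A and B of a K24 minor with m missing branch sets are joined by m edges,
   then these edges cannot be subdivided together, because the subdividing vertices supply the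
   missing branch sets. For all other edges, for two spokes of a wheel, and for r = 2 for the pair
   v_1 v_(n-1), v_(n-2) v_(n-1), such hubs and branch sets can be written down. *)
theory Submission
  imports Defs
begin

section \<open>Connected vertex sets and K24 minors\<close>

text \<open>Subdividing path edges of a double fan only lengthens its path. What has to be arranged
  is that every other edge starts at one of the two path ends and that the ranges of the ends
  overlap in at most one index \<open>k\<close>. For the spine this is the inequality
  \<open>s + 1 \<le> n - r\<close>. It comes from K24-freeness: otherwise v_2, v_(n-r), v_(n-r+1),
  v_(n-1) would be four common neighbours of v_1 and v_n. For r = 2 a second path exists because
  v_(n-2) can trade places with v_1: apart from v_(n-3) and possibly v_n, its neighbours are just
  v_1 and v_(n-1). For r \<ge> 3 the chord v_1 v_(n-3) spoils this, and it yields the obstruction to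
  v_1 v_(n-1). In the case r = 2, the alternative between s \<ge> 4 and the presence of v_1 v_n
  serves the single edge v_3 v_n: its obstruction uses either the chord v_5 v_n or the edge v_1 v_n.
  3-connectedness forces the wheel when r = 1.\<close>

definition connected_in :: "'v graph \<Rightarrow> 'v set \<Rightarrow> bool" where
  "connected_in G S \<longleftrightarrow> S \<subseteq> verts G \<and> connected_graph (induced G S)"

definition touches :: "'v graph \<Rightarrow> 'v set \<Rightarrow> 'v set \<Rightarrow> bool" where
  "touches G S T \<longleftrightarrow> (\<exists>u \<in> S. \<exists>v \<in> T. adj G u v)"

lemma adj_commute: "adj G u v \<longleftrightarrow> adj G v u"
  by (simp add: adj_def insert_commute)

lemma touches_commute: "touches G S T \<longleftrightarrow> touches G T S"
  unfolding touches_def by (metis adj_commute)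

lemma adj_induced: "adj (induced G S) = (\<lambda>u v. u \<in> S \<and> v \<in> S \<and> adj G u v)"
  by (auto simp: fun_eq_iff adj_def induced_def)

lemma connected_in_iff:
  "connected_in G S \<longleftrightarrow>
     S \<subseteq> verts G \<and> S \<noteq> {} \<and>
     (\<forall>u \<in> S. \<forall>v \<in> S. (\<lambda>u v. u \<in> S \<and> v \<in> S \<and> adj G u v)\<^sup>*\<^sup>* u v)"
  by (auto simp: connected_in_def connected_graph_def adj_induced[symmetric] induced_def
      Int_absorb1)

text \<open>Adjacency is symmetric, so it is enough to reach every vertex from one root
  \<open>c\<close>.\<close>

lemma connected_inI:
  assumes "S \<subseteq> verts G" "c \<in> S"
    and "\<And>v. v \<in> S \<Longrightarrow> (\<lambda>u v. u \<in> S \<and> v \<in> S \<and> adj G u v)\<^sup>*\<^sup>* c v"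
  shows "connected_in G S"
proof -
  have "symp (\<lambda>u v. u \<in> S \<and> v \<in> S \<and> adj G u v)"
    by (auto simp: symp_def adj_commute)
  then have "(\<lambda>u v. u \<in> S \<and> v \<in> S \<and> adj G u v)\<^sup>*\<^sup>* v c" if "v \<in> S" for v
    using assms(3)[OF that] by (metis sympD symp_rtranclp)
  then show ?thesis
    unfolding connected_in_iff using assms by (meson empty_iff rtranclp_trans)
qed

text \<open>On a path inside \<open>S\<close> from \<open>x\<close> to \<open>y\<close> there is a
  step at which \<open>P\<close> is lost. The separation arguments for double fans take
  \<open>P\<close> to be one side of a cut and inspect the crossing edge.\<close>

lemma connected_in_exit:
  assumes "connected_in G S" "x \<in> S" "P x" "y \<in> S" "\<not> P y"
  obtains u v where "u \<in> S" "v \<in> S" "P u" "\<not> P v" "adj G u v"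
proof -
  have "(\<lambda>u v. u \<in> S \<and> v \<in> S \<and> adj G u v)\<^sup>*\<^sup>* x y"
    using assms by (simp add: connected_in_iff)
  then have "\<not> P y \<longrightarrow> (\<exists>u v. u \<in> S \<and> v \<in> S \<and> P u \<and> \<not> P v \<and> adj G u v)"
    using assms(3) by (induction rule: rtranclp_induct) auto
  then show ?thesis using assms(5) that by auto
qed

lemma connected_in_singleton: "v \<in> verts G \<Longrightarrow> connected_in G {v}"
  by (auto simp: connected_in_iff)

lemma connected_in_Un:
  assumes "connected_in G S" "connected_in G T" "u \<in> S" "v \<in> T" "adj G u v"
  shows "connected_in G (S \<union> T)"
proof (rule connected_inI)
  let ?R = "\<lambda>X u v. u \<in> X \<and> v \<in> X \<and> adj G u v"
  show "S \<union> T \<subseteq> verts G" "u \<in> S \<union> T"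
    using assms by (auto simp: connected_in_iff)
  have uv: "?R (S \<union> T) u v" using assms by auto
  have *: "(?R (S \<union> T))\<^sup>*\<^sup>* x y" if "(?R S)\<^sup>*\<^sup>* x y \<or> (?R T)\<^sup>*\<^sup>* x y" for x y
  proof -
    have "?R S \<le> ?R (S \<union> T)" "?R T \<le> ?R (S \<union> T)" by auto
    then have "(?R S)\<^sup>*\<^sup>* \<le> (?R (S \<union> T))\<^sup>*\<^sup>*" "(?R T)\<^sup>*\<^sup>* \<le> (?R (S \<union> T))\<^sup>*\<^sup>*"
      by (simp_all only: rtranclp_mono)
    then show ?thesis using that by blast
  qed
  show "(?R (S \<union> T))\<^sup>*\<^sup>* u w" if "w \<in> S \<union> T" for w
  proof (cases "w \<in> S")
    case True
    then have "(?R S)\<^sup>*\<^sup>* u w" using assms(1,3) by (simp add: connected_in_iff)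
    then show ?thesis using * by blast
  next
    case False
    then have "(?R T)\<^sup>*\<^sup>* v w" using that assms(2,4) by (simp add: connected_in_iff)
    then have "(?R (S \<union> T))\<^sup>*\<^sup>* v w" using * by blast
    with uv show ?thesis by (rule converse_rtranclp_into_rtranclp)
  qed
qed

lemma connected_in_insert:
  assumes "connected_in G S" "v \<in> verts G" "u \<in> S" "adj G u v"
  shows "connected_in G (insert v S)"
  using connected_in_Un[OF assms(1) connected_in_singleton[OF assms(2)] assms(3) _ assms(4)]
  by simp

lemma K24_minorI:
  fixes G :: "'a graph" and C :: "nat \<Rightarrow> 'a set"
  assumes "connected_in G A" "connected_in G B" "A \<inter> B = {}"
    and "\<And>i. i < 4 \<Longrightarrow> connected_in G (C i) \<and> C i \<inter> A = {} \<and> C i \<inter> B = {} \<and>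
                touches G (C i) A \<and> touches G (C i) B"
    and "\<And>i j. i < j \<Longrightarrow> j < 4 \<Longrightarrow> C i \<inter> C j = {}"
  shows "\<not> K24_minor_free G"
proof -
  define D :: "nat + nat \<Rightarrow> 'a set" where "D = case_sum (\<lambda>i. if i = 0 then A else B) C"
  have D: "D (Inl 0) = A" "D (Inl (Suc 0)) = B" "D (Inr i) = C i" for i
    by (auto simp: D_def)
  have CC: "C i \<inter> C j = {}" if "i < 4" "j < 4" "i \<noteq> j" for i j
    using that assms(5)[of i j] assms(5)[of j i] by (cases "i < j") auto
  have less2: "{..<2::nat} = {0, Suc 0}" by auto
  have "is_minor (complete_bipartite 2 4) G"
    unfolding is_minor_def
  proof (intro exI[of _ D] conjI)
    show "\<forall>x\<in>verts (complete_bipartite 2 4). D x \<subseteq> verts G \<and> connected_graph (induced G (D x))"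
    proof
      fix x assume "x \<in> verts (complete_bipartite 2 4)"
      then have "x = Inl 0 \<or> x = Inl (Suc 0) \<or> (\<exists>i<4. x = Inr i)"
        by (auto simp: complete_bipartite_def less2)
      then have "connected_in G (D x)"
        using assms(1,2,4) by (elim disjE exE conjE) (simp_all add: D)
      then show "D x \<subseteq> verts G \<and> connected_graph (induced G (D x))"
        by (simp add: connected_in_def)
    qed
    show "\<forall>x\<in>verts (complete_bipartite 2 4). \<forall>y\<in>verts (complete_bipartite 2 4).
            x \<noteq> y \<longrightarrow> D x \<inter> D y = {}"
    proof (intro ballI impI)
      fix x y assume "x \<in> verts (complete_bipartite 2 4)" "y \<in> verts (complete_bipartite 2 4)"
      then have "x = Inl 0 \<or> x = Inl (Suc 0) \<or> (\<exists>i<4. x = Inr i)"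
        "y = Inl 0 \<or> y = Inl (Suc 0) \<or> (\<exists>i<4. y = Inr i)"
        by (auto simp: complete_bipartite_def less2)
      moreover have "A \<inter> C i = {}" "B \<inter> C i = {}" "C i \<inter> A = {}" "C i \<inter> B = {}" if "i < 4" for i
        using assms(4)[OF that] by blast+
      moreover have "B \<inter> A = {}" using assms(3) by blast
      moreover assume "x \<noteq> y"
      ultimately show "D x \<inter> D y = {}"
        using assms(3) CC by (elim disjE exE conjE) (simp_all add: D)
    qed
    show "\<forall>x\<in>verts (complete_bipartite 2 4). \<forall>y\<in>verts (complete_bipartite 2 4).
            adj (complete_bipartite 2 4) x y \<longrightarrow> (\<exists>u\<in>D x. \<exists>v\<in>D y. adj G u v)"
    proof (intro ballI impI)
      fix x y assume "adj (complete_bipartite 2 4) x y"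
      then obtain i j where ij: "i < 2" "j < 4" "{x, y} = {Inl i, Inr j}"
        by (auto simp: adj_def complete_bipartite_def)
      then have "touches G (D (Inr j)) (D (Inl i))"
        using assms(4)[OF ij(2)] less_2_cases[OF ij(1)] by (elim disjE) (simp_all add: D)
      then have "touches G (D x) (D y)"
        using ij(3) unfolding doubleton_eq_iff by (elim disjE conjE) (simp_all add: touches_commute)
      then show "\<exists>u\<in>D x. \<exists>v\<in>D y. adj G u v" by (simp add: touches_def)
    qed
  qed
  then show ?thesis by (simp add: K24_minor_free_def)
qed

lemma K24_minorE:
  fixes G :: "'a graph"
  assumes "\<not> K24_minor_free G"
  obtains A B and C :: "nat \<Rightarrow> 'a set"
  where "connected_in G A" "connected_in G B" "A \<inter> B = {}"
    and "\<forall>i<4. connected_in G (C i) \<and> C i \<inter> A = {} \<and> C i \<inter> B = {} \<and>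
                touches G (C i) A \<and> touches G (C i) B"
    and "\<forall>i<4. \<forall>j<4. i \<noteq> j \<longrightarrow> C i \<inter> C j = {}"
proof -
  let ?K = "complete_bipartite 2 4"
  from assms obtain D where D:
    "\<forall>x\<in>verts ?K. D x \<subseteq> verts G \<and> connected_graph (induced G (D x))"
    "\<forall>x\<in>verts ?K. \<forall>y\<in>verts ?K. x \<noteq> y \<longrightarrow> D x \<inter> D y = {}"
    "\<forall>x\<in>verts ?K. \<forall>y\<in>verts ?K. adj ?K x y \<longrightarrow> (\<exists>u\<in>D x. \<exists>v\<in>D y. adj G u v)"
    unfolding K24_minor_free_def is_minor_def not_not by (elim exE conjE) 
  have
    1: "\<And>x. x \<in> verts ?K \<Longrightarrow> connected_in G (D x)" and
    2: "\<And>x y. x \<in> verts ?K \<Longrightarrow> y \<in> verts ?K \<Longrightarrow> x \<noteq> y \<Longrightarrow> D x \<inter> D y = {}" and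
    3: "\<And>x y. x \<in> verts ?K \<Longrightarrow> y \<in> verts ?K \<Longrightarrow> adj ?K x y \<Longrightarrow> touches G (D x) (D y)"
    using D by (simp_all add: connected_in_def touches_def)
  have V: "Inl 0 \<in> verts ?K" "Inl 1 \<in> verts ?K" "\<And>i. i < 4 \<Longrightarrow> Inr i \<in> verts ?K"
    by (auto simp: complete_bipartite_def)
  have E: "adj ?K (Inr j) (Inl i)" if "i < 2" "j < 4" for i j
    using that by (auto simp: adj_def complete_bipartite_def insert_commute)
  show thesis
  proof (rule that[of "D (Inl 0)" "D (Inl 1)" "\<lambda>i. D (Inr i)"])
    show "\<forall>i<4. connected_in G (D (Inr i)) \<and> D (Inr i) \<inter> D (Inl 0) = {} \<and>
        D (Inr i) \<inter> D (Inl 1) = {} \<and> touches G (D (Inr i)) (D (Inl 0)) \<and>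
        touches G (D (Inr i)) (D (Inl 1))"
      using V E 1 2 3 by simp
  qed (use V 1 2 in auto)
qed

lemma connected_in_image:
  assumes "connected_in G S" "f ` verts G \<subseteq> verts H"
    and "\<And>u v. u \<in> verts G \<Longrightarrow> v \<in> verts G \<Longrightarrow> adj G u v \<Longrightarrow> adj H (f u) (f v)"
  shows "connected_in H (f ` S)"
proof -
  obtain c where c: "c \<in> S" using assms(1) by (auto simp: connected_in_iff)
  have "(\<lambda>u v. u \<in> f ` S \<and> v \<in> f ` S \<and> adj H u v)\<^sup>*\<^sup>* (f c) (f v)" if "v \<in> S" for v
  proof -
    have "(\<lambda>u v. u \<in> S \<and> v \<in> S \<and> adj G u v)\<^sup>*\<^sup>* c v"
      using assms(1) c that by (simp add: connected_in_iff)
    then show ?thesis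
    proof (induction rule: rtranclp_induct)
      case (step y z)
      have "S \<subseteq> verts G" using assms(1) by (simp add: connected_in_def)
      then have "adj H (f y) (f z)" using step.hyps assms(3) by blast
      then have "f y \<in> f ` S \<and> f z \<in> f ` S \<and> adj H (f y) (f z)" using step.hyps by simp
      with step.IH show ?case by (rule rtranclp.rtrancl_into_rtrancl)
    qed simp
  qed
  moreover have "f ` S \<subseteq> verts H"
    using assms(1,2) by (auto simp: connected_in_def)
  ultimately show ?thesis using c by (auto intro!: connected_inI[of _ _ "f c"])
qed

text \<open>Images of branch sets under a homomorphism stay connected and adjacent, and injectivity
  keeps them disjoint. \<open>H\<close> may have further vertices and edges, so being a subgraph of
  a double fan suffices.\<close>

lemma K24_minor_free_embedding:
  assumes "K24_minor_free H" "inj_on f (verts G)" "f ` verts G \<subseteq> verts H"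
    and "\<And>u v. u \<in> verts G \<Longrightarrow> v \<in> verts G \<Longrightarrow> adj G u v \<Longrightarrow> adj H (f u) (f v)"
  shows "K24_minor_free G"
proof (rule ccontr)
  assume "\<not> K24_minor_free G"
  then obtain A B and C :: "nat \<Rightarrow> _" where *: "connected_in G A" "connected_in G B" "A \<inter> B = {}"
    "\<forall>i<4. connected_in G (C i) \<and> C i \<inter> A = {} \<and> C i \<inter> B = {} \<and>
       touches G (C i) A \<and> touches G (C i) B"
    "\<forall>i<4. \<forall>j<4. i \<noteq> j \<longrightarrow> C i \<inter> C j = {}"
    by (rule K24_minorE)
  have disj: "f ` S \<inter> f ` T = {}" if "S \<inter> T = {}" "connected_in G S" "connected_in G T" for S T
    using that inj_on_image_Int[OF assms(2), of S T] by (simp add: connected_in_def)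
  have touch: "touches H (f ` S) (f ` T)"
    if "touches G S T" "connected_in G S" "connected_in G T" for S T
  proof -
    from that(1) obtain u v where "u \<in> S" "v \<in> T" "adj G u v"
      unfolding touches_def by (elim bexE)
    moreover from this have "adj H (f u) (f v)"
      using \<open>connected_in G S\<close> \<open>connected_in G T\<close> by (intro assms(4)) (auto simp: connected_in_def)
    ultimately show ?thesis by (auto simp: touches_def)
  qed
  note image = connected_in_image[OF _ assms(3,4)]
  have "\<not> K24_minor_free H"
  proof (rule K24_minorI[of _ "f ` A" "f ` B" "\<lambda>i. f ` C i"])
    show "connected_in H (f ` A)" by (rule image) (rule *)
    show "connected_in H (f ` B)" by (rule image) (rule *)
    show "f ` A \<inter> f ` B = {}" by (rule disj) (rule *)+
  next
    fix i :: nat assume "i < 4"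
    with *(4) have "connected_in G (C i)" "C i \<inter> A = {}" "C i \<inter> B = {}"
      "touches G (C i) A" "touches G (C i) B" by simp_all
    with *(1,2)
    show "connected_in H (f ` C i) \<and> f ` C i \<inter> f ` A = {} \<and> f ` C i \<inter> f ` B = {} \<and>
        touches H (f ` C i) (f ` A) \<and> touches H (f ` C i) (f ` B)"
      by (intro conjI disj touch image) assumption+
  next
    fix i j :: nat assume "i < j" "j < 4"
    with * show "f ` C i \<inter> f ` C j = {}" by (intro disj) simp_all
  qed
  then show False using assms(1) by simp
qed

section \<open>Double fans\<close>

text \<open>The fans are crossed: each end is joined to the far part of the path, and both reach
  \<open>k\<close>. For \<open>lo = 1\<close> and \<open>hi = n\<close> this is the graph G^+ with r
  = n - k and s = k - 1 (when these are admissible), the extremal case r + s = n - 1.\<close>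

definition fan_edge :: "nat \<Rightarrow> nat \<Rightarrow> nat \<Rightarrow> nat \<Rightarrow> nat \<Rightarrow> bool" where
  "fan_edge lo k hi u v \<longleftrightarrow>
     lo \<le> u \<and> u < v \<and> v \<le> hi \<and> (v = Suc u \<or> u = lo \<and> k \<le> v \<or> v = hi \<and> u \<le> k)"

definition double_fan :: "nat \<Rightarrow> nat \<Rightarrow> nat \<Rightarrow> nat graph" where
  "double_fan lo k hi = Graph {lo..hi} {{u, v} | u v. fan_edge lo k hi u v}"

lemma verts_double_fan [simp]: "verts (double_fan lo k hi) = {lo..hi}"
  by (simp add: double_fan_def)

lemma adj_double_fan:
  "adj (double_fan lo k hi) u v \<longleftrightarrow> fan_edge lo k hi u v \<or> fan_edge lo k hi v u"
  by (auto simp: adj_def double_fan_def doubleton_eq_iff)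

context
  fixes lo k hi :: nat
  assumes k: "lo < k" "k < hi"
begin

text \<open>Without \<open>lo\<close> and \<open>hi\<close> only path edges remain, and none of them
  can jump over a missing vertex \<open>y\<close>.\<close>

lemma double_fan_interval:
  assumes "connected_in (double_fan lo k hi) S" "lo \<notin> S" "hi \<notin> S"
    and "x \<in> S" "z \<in> S" "x \<le> y" "y \<le> z"
  shows "y \<in> S"
proof (rule ccontr)
  assume y: "y \<notin> S"
  have "x < y" "\<not> z < y" using assms y by (auto simp: le_less)
  then obtain u v where "u \<in> S" "v \<in> S" "u < y" "\<not> v < y" "adj (double_fan lo k hi) u v"
    using connected_in_exit[OF assms(1), of x "\<lambda>w. w < y" z] assms(4,5) by blast
  moreover from this y have "v \<noteq> y" "u \<noteq> lo" "u \<noteq> hi" "v \<noteq> lo" "v \<noteq> hi" using assms by auto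
  ultimately show False by (auto simp: adj_double_fan fan_edge_def)
qed

text \<open>A vertex strictly between \<open>lo\<close> and \<open>k\<close> has, besides
  \<open>hi\<close>, only its neighbours on the path. Vertices \<open>p < x < q\<close> missing from
  \<open>A\<close> would therefore enclose \<open>x\<close> in a window that no edge inside
  \<open>A\<close> leaves, although \<open>lo\<close> lies outside.\<close>

lemma double_fan_left_part:
  assumes "connected_in (double_fan lo k hi) A" "lo \<in> A" "hi \<notin> A" "x \<in> A" "x \<le> k"
  shows "(\<forall>y. lo \<le> y \<and> y \<le> x \<longrightarrow> y \<in> A) \<or> (\<forall>y. x \<le> y \<and> y \<le> k \<longrightarrow> y \<in> A)"
proof (rule ccontr)
  assume "\<not> ?thesis"
  then obtain p q where pq: "lo \<le> p" "p \<le> x" "p \<notin> A" "x \<le> q" "q \<le> k" "q \<notin> A" by blast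
  then have *: "lo < p" "p < x" "x < q" using assms by (auto simp: le_less)
  then obtain u v where "u \<in> A" "v \<in> A" "p < u \<and> u < q" "\<not> (p < v \<and> v < q)"
    "adj (double_fan lo k hi) u v"
    using connected_in_exit[OF assms(1), of x "\<lambda>w. p < w \<and> w < q" lo] assms(2,4) by auto
  moreover from this pq assms(3) have "v \<noteq> p" "v \<noteq> q" "v \<noteq> hi" by auto
  ultimately show False using * pq k by (auto simp: adj_double_fan fan_edge_def)
qed

text \<open>The mirror image of \<open>double_fan_left_part\<close>, with \<open>lo\<close> and
  \<open>hi\<close> exchanged.\<close>

lemma double_fan_right_part:
  assumes "connected_in (double_fan lo k hi) B" "hi \<in> B" "lo \<notin> B" "x \<in> B" "k \<le> x"
  shows "(\<forall>y. x \<le> y \<and> y \<le> hi \<longrightarrow> y \<in> B) \<or> (\<forall>y. k \<le> y \<and> y \<le> x \<longrightarrow> y \<in> B)"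
proof (rule ccontr)
  assume "\<not> ?thesis"
  then obtain p q where pq: "x \<le> p" "p \<le> hi" "p \<notin> B" "k \<le> q" "q \<le> x" "q \<notin> B" by blast
  then have *: "p < hi" "x < p" "q < x" using assms by (auto simp: le_less)
  then obtain u v where "u \<in> B" "v \<in> B" "q < u \<and> u < p" "\<not> (q < v \<and> v < p)"
    "adj (double_fan lo k hi) u v"
    using connected_in_exit[OF assms(1), of x "\<lambda>w. q < w \<and> w < p" hi] assms(2,4) by auto
  moreover from this pq assms(3) have "v \<noteq> p" "v \<noteq> q" "v \<noteq> lo" by auto
  ultimately show False using * pq k by (auto simp: adj_double_fan fan_edge_def)
qed

text \<open>A hub avoiding both \<open>lo\<close> and \<open>hi\<close> is an interval \<open>{a..b}\<close> of the path, whose only possible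
  neighbours \<open>lo\<close>, \<open>hi\<close>, \<open>a - 1\<close>, \<open>b + 1\<close> lie in different branch sets. The other hub is then
  separated from \<open>a - 1\<close> or from \<open>b + 1\<close>.\<close>

lemma double_fan_hub:
  fixes C :: "nat \<Rightarrow> nat set"
  defines "D \<equiv> double_fan lo k hi"
  assumes A: "connected_in D A" and B: "connected_in D B" and AB: "A \<inter> B = {}"
    and C: "\<forall>i<4. connected_in D (C i) \<and> C i \<inter> A = {} \<and> C i \<inter> B = {} \<and>
              touches D (C i) A \<and> touches D (C i) B"
    and CC: "\<forall>i<4. \<forall>j<4. i \<noteq> j \<longrightarrow> C i \<inter> C j = {}"
  shows "lo \<in> A \<or> hi \<in> A"
proof (rule ccontr)
  assume "\<not> ?thesis"
  then have no: "lo \<notin> A" "hi \<notin> A" by auto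
  have sub: "A \<subseteq> {lo..hi}" "A \<noteq> {}" using A by (auto simp: D_def connected_in_iff)
  then have fin: "finite A" by (auto intro: finite_subset)
  define a b where "a = Min A" and "b = Max A"
  have ab: "a \<in> A" "b \<in> A" "\<And>x. x \<in> A \<Longrightarrow> a \<le> x \<and> x \<le> b"
    using fin sub by (auto simp: a_def b_def)
  have ivl: "x \<in> A" if "a \<le> x" "x \<le> b" for x
    using double_fan_interval[OF A[unfolded D_def] no] ab that by blast
  have lo_a: "lo < a" "b < hi" "a \<le> b" using ab sub no by (auto simp: le_less)
  \<comment> \<open>Pigeonhole: each of the four disjoint \<open>C i\<close> uses up a vertex of
    \<open>N\<close>, which has at most four. Hence these four are distinct and each lies in exactly
    one branch set.\<close>
  define N where "N = {lo, hi, a - 1, Suc b}"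
  have "\<exists>x. x \<in> C i \<inter> N" if "i < 4" for i
  proof -
    have "touches D (C i) A" "C i \<inter> A = {}" using C that by simp_all
    then obtain x v where xv: "x \<in> C i" "v \<in> A" "adj D x v" "x \<notin> A"
      unfolding touches_def by blast
    have "v \<noteq> lo" "v \<noteq> hi" using xv no by auto
    then consider "x = lo" | "x = hi" | "v = Suc x" | "x = Suc v"
      using xv(3) by (auto simp: D_def adj_double_fan fan_edge_def)
    then have "x \<in> N"
    proof cases
      case 3
      with xv ab(3)[of v] ivl[of x] show ?thesis by (cases "a = v") (auto simp: N_def)
    next
      case 4
      with xv ab(3)[of v] ivl[of x] show ?thesis by (cases "b = v") (auto simp: N_def)
    qed (auto simp: N_def)
    with xv show ?thesis by blast
  qed
  then obtain f where f: "\<And>i. i < 4 \<Longrightarrow> f i \<in> C i \<inter> N" by metis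
  have "inj_on f {..<4}"
    using f CC unfolding inj_on_def by (metis IntD1 IntI empty_iff lessThan_iff)
  then have "card (f ` {..<4}) = 4" by (simp add: card_image)
  moreover have "f ` {..<4} \<subseteq> N" using f by auto
  moreover have "finite N" "card N \<le> 4" by (auto simp: N_def card_insert_if)
  ultimately have N: "card N = 4" "f ` {..<4} = N"
    by (metis card_mono le_antisym, metis card_seteq)
  \<comment> \<open>Distinctness leaves room at both ends of the interval.\<close>
  have "a - 1 \<noteq> lo" "Suc b \<noteq> hi" using N(1) by (auto simp: N_def card_insert_if split: if_splits)
  have N_C: "\<exists>i<4. f i = x" if "x \<in> N" for x using N(2) that by auto
  have C_N: "x = f i" if "x \<in> N" "x \<in> C i" "i < 4" for x i
    using N_C[OF that(1)] f CC that by (metis IntD1 IntI empty_iff)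
  have inN: "lo \<in> N" "hi \<in> N" "a - 1 \<in> N" "Suc b \<in> N" by (auto simp: N_def)
  \<comment> \<open>Both path ends belong to branch sets \<open>C i\<close>, so \<open>B\<close> is
    an interval as well and lies wholly on one side of \<open>A\<close>.\<close>
  have "lo \<notin> B" "hi \<notin> B" using N_C inN f C by (metis IntD1 IntI empty_iff)+
  note B_ivl = double_fan_interval[OF B[unfolded D_def] this]
  obtain b0 where b0: "b0 \<in> B" using B by (auto simp: connected_in_iff)
  with AB ivl have "b0 < a \<or> b < b0" by (meson disjoint_iff not_le)
  then show False
  proof
    assume "b < b0"
    then have B_gt: "b < x" if "x \<in> B" for x
      using B_ivl[OF that b0, of b] AB ab(2) by (meson disjoint_iff less_imp_le not_le)
    \<comment> \<open>The branch set of \<open>a - 1\<close> contains none of \<open>lo\<close>,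
      \<open>hi\<close>, \<open>a\<close>. It thus stays to the left of \<open>A\<close>, while
      \<open>B\<close> lies to the right of \<open>A\<close>, and no path edge spans
      \<open>A\<close>.\<close>
    obtain i where i: "i < 4" "f i = a - 1" using N_C inN by blast
    have "a - 1 \<noteq> hi" using lo_a by linarith
    then have mem: "a - 1 \<in> C i" "lo \<notin> C i" "hi \<notin> C i" "a \<notin> C i"
      using i f[of i] C_N[OF inN(1), of i] C_N[OF inN(2), of i] lo_a C ab \<open>a - 1 \<noteq> lo\<close>
      by (auto simp: N_def)
    have lt: "x < a" if "x \<in> C i" for x
      using double_fan_interval[of "C i" "a - 1" x a] mem that C i
      by (metis D_def diff_le_self not_le)
    have "touches D (C i) B" using C i by simp
    then obtain u v where "u \<in> C i" "v \<in> B" "adj D u v" unfolding touches_def by blast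
    moreover from this mem have "u \<noteq> lo" "u < a" using lt by auto
    moreover have "b < v" "v \<noteq> hi" "v \<noteq> lo" using calculation B_gt \<open>lo \<notin> B\<close> \<open>hi \<notin> B\<close> by auto
    ultimately show False using lo_a by (auto simp: D_def adj_double_fan fan_edge_def)
  next
    assume "b0 < a"
    then have B_lt: "x < a" if "x \<in> B" for x
      using B_ivl[OF b0 that, of a] AB ab(1) by (meson disjoint_iff less_imp_le not_le)
    obtain i where i: "i < 4" "f i = Suc b" using N_C inN by blast
    have mem: "Suc b \<in> C i" "lo \<notin> C i" "hi \<notin> C i" "b \<notin> C i"
      using i f[of i] C_N[OF inN(1), of i] C_N[OF inN(2), of i] lo_a C ab \<open>Suc b \<noteq> hi\<close>
      by (auto simp: N_def)
    have gt: "b < x" if "x \<in> C i" for x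
      using double_fan_interval[of "C i" x "Suc b" b] mem that C i
      by (metis D_def le_SucI le_refl not_le)
    have "touches D (C i) B" using C i by simp
    then obtain u v where "u \<in> C i" "v \<in> B" "adj D u v" unfolding touches_def by blast
    moreover from this mem have "u \<noteq> hi" "b < u" using gt by auto
    moreover have "v < a" "v \<noteq> hi" "v \<noteq> lo" using calculation B_lt \<open>lo \<notin> B\<close> \<open>hi \<notin> B\<close> by auto
    ultimately show False using lo_a by (auto simp: D_def adj_double_fan fan_edge_def)
  qed
qed

text \<open>With \<open>lo \<in> A\<close> and \<open>hi \<in> B\<close>, a branch set touching \<open>A\<close> and \<open>B\<close> is the leftmost one next to
  an initial segment in \<open>A\<close>, the rightmost one next to a final segment in \<open>B\<close>, or the one that is
  closest to \<open>k\<close>; so there are at most three of them.\<close>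

lemma double_fan_no_four:
  fixes C :: "nat \<Rightarrow> nat set"
  defines "D \<equiv> double_fan lo k hi"
  assumes A: "connected_in D A" and B: "connected_in D B" and AB: "A \<inter> B = {}"
    and C: "\<forall>i<4. connected_in D (C i) \<and> C i \<inter> A = {} \<and> C i \<inter> B = {} \<and>
              touches D (C i) A \<and> touches D (C i) B"
    and CC: "\<forall>i<4. \<forall>j<4. i \<noteq> j \<longrightarrow> C i \<inter> C j = {}"
    and lo: "lo \<in> A" and hi: "hi \<in> B"
  shows False
proof -
  define L where "L i \<longleftrightarrow> (\<exists>c\<in>C i. \<forall>x. lo \<le> x \<and> x < c \<longrightarrow> x \<in> A)" for i
  define R where "R i \<longleftrightarrow> (\<exists>c\<in>C i. \<forall>x. c < x \<and> x \<le> hi \<longrightarrow> x \<in> B)" for i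
  define M where "M i \<longleftrightarrow> (\<exists>c\<in>C i. (\<forall>x. c < x \<and> x \<le> k \<longrightarrow> x \<in> A) \<and>
    (\<forall>x. k \<le> x \<and> x < c \<longrightarrow> x \<in> B))" for i
  have lo_hi: "hi \<notin> A" "lo \<notin> B" using AB lo hi by auto
  have Csub: "lo \<le> x \<and> x \<le> hi \<and> x \<notin> A \<and> x \<notin> B" if "x \<in> C i" "i < 4" for x i
  proof -
    have "C i \<subseteq> {lo..hi}" "C i \<inter> A = {}" "C i \<inter> B = {}"
      using C that(2) by (simp_all add: connected_in_def D_def)
    with that(1) show ?thesis by auto
  qed
  have Cne: "x \<noteq> y" if "x \<in> C i" "y \<in> C j" "i < 4" "j < 4" "i \<noteq> j" for x y i j
    using CC that by blast
  have LRM: "L i \<or> R i \<or> M i" if i: "i < 4" for i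
  proof (cases "k \<in> C i")
    case True
    then have "M i" unfolding M_def by (intro bexI[of _ k]) auto
    then show ?thesis by simp
  next
    case False
    have Ci: "connected_in (double_fan lo k hi) (C i)" "touches D (C i) A" "touches D (C i) B"
      using C i by (simp_all add: D_def)
    have "lo \<notin> C i" "hi \<notin> C i" using Csub i lo hi by blast+
    note ivl = double_fan_interval[OF Ci(1) this]
    \<comment> \<open>An interval that misses \<open>k\<close> lies on one side of it.\<close>
    have "(\<forall>x\<in>C i. x < k) \<or> (\<forall>x\<in>C i. k < x)"
      using ivl False by (metis linorder_neqE_nat less_imp_le)
    then show ?thesis
    proof
      assume lt: "\<forall>x\<in>C i. x < k"
      obtain u v where uv: "u \<in> C i" "v \<in> A" "adj D u v"
        using Ci(2) unfolding touches_def by blast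
      have u: "lo \<le> u" "u < k" "u \<noteq> lo" "u \<notin> A" using Csub[OF uv(1) i] lt uv lo by auto
      \<comment> \<open>To the left of \<open>k\<close> neither fan helps to touch \<open>A\<close>:
        \<open>hi\<close> is in \<open>B\<close>, and the fan of \<open>lo\<close> starts at
        \<open>k\<close>. The contact is a path edge.\<close>
      have "v \<noteq> hi" using uv lo_hi by auto
      then have v: "v = Suc u \<or> u = Suc v" "lo \<le> v" "v \<le> k"
        using uv(3) u k by (auto simp: D_def adj_double_fan fan_edge_def)
      consider "\<forall>y. lo \<le> y \<and> y \<le> v \<longrightarrow> y \<in> A" | "\<forall>y. v \<le> y \<and> y \<le> k \<longrightarrow> y \<in> A"
        using double_fan_left_part[OF A[unfolded D_def] lo lo_hi(1) uv(2) v(3)] by blast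
      then show ?thesis
      proof cases
        case 1
        then have "u = Suc v" using v u by auto
        with 1 uv(1) have "L i" by (auto simp: L_def less_Suc_eq_le intro!: bexI[of _ u])
        then show ?thesis by simp
      next
        case 2
        then have "v = Suc u" using v u by auto
        with 2 uv(1) u have "M i" by (auto simp: M_def Suc_le_eq intro!: bexI[of _ u])
        then show ?thesis by simp
      qed
    next
      assume gt: "\<forall>x\<in>C i. k < x"
      obtain u v where uv: "u \<in> C i" "v \<in> B" "adj D u v"
        using Ci(3) unfolding touches_def by blast
      have u: "u \<le> hi" "k < u" "u \<noteq> hi" "u \<notin> B" using Csub[OF uv(1) i] gt uv hi by auto
      have "v \<noteq> lo" using uv lo_hi by auto
      then have v: "v = Suc u \<or> u = Suc v" "v \<le> hi" "k \<le> v"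
        using uv(3) u k by (auto simp: D_def adj_double_fan fan_edge_def)
      consider "\<forall>y. v \<le> y \<and> y \<le> hi \<longrightarrow> y \<in> B" | "\<forall>y. k \<le> y \<and> y \<le> v \<longrightarrow> y \<in> B"
        using double_fan_right_part[OF B[unfolded D_def] hi lo_hi(2) uv(2) v(3)] by blast
      then show ?thesis
      proof cases
        case 1
        then have "v = Suc u" using v u by auto
        with 1 uv(1) have "R i" by (auto simp: R_def Suc_le_eq intro!: bexI[of _ u])
        then show ?thesis by simp
      next
        case 2
        then have "u = Suc v" using v u by auto
        with 2 uv(1) u have "M i" by (auto simp: M_def less_Suc_eq_le intro!: bexI[of _ u])
        then show ?thesis by simp
      qed
    qed
  qed
  have uniq: "\<not> (L i \<and> L j)" "\<not> (R i \<and> R j)" "\<not> (M i \<and> M j)" if ij: "i < 4" "j < 4" "i \<noteq> j" for i j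
  proof -
    show "\<not> (L i \<and> L j)"
      unfolding L_def using Csub Cne ij by (metis linorder_neqE_nat)
    show "\<not> (R i \<and> R j)"
      unfolding R_def using Csub Cne ij by (metis linorder_neqE_nat)
    \<comment> \<open>If \<open>c < c'\<close>, then \<open>k\<close> lies strictly between them,
      since \<open>c\<close> is not in \<open>B\<close> and \<open>c'\<close> not in
      \<open>A\<close>; but then both hubs contain \<open>k\<close>.\<close>
    have "\<not> c < c'"
      if "i < 4" "j < 4" "c \<in> C i" "c' \<in> C j" "\<forall>x. c < x \<and> x \<le> k \<longrightarrow> x \<in> A" "\<forall>x. k \<le> x \<and> x < c' \<longrightarrow> x \<in> B"
      for c c' i j
    proof
      assume "c < c'"
      moreover have "c' \<notin> A" "c \<notin> B" using Csub that by blast+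
      ultimately have "c < k" "k < c'" using that by (meson not_le)+
      then have "k \<in> A" "k \<in> B" using that by auto
      then show False using AB by auto
    qed
    then show "\<not> (M i \<and> M j)"
      unfolding M_def using Cne ij by (metis linorder_neqE_nat)
  qed
  \<comment> \<open>Three labels, each carried by at most one index, cannot cover four
    indices.\<close>
  show False
    using LRM[of 0] LRM[of 1] LRM[of 2] LRM[of 3] uniq[of 0 1] uniq[of 0 2] uniq[of 0 3]
      uniq[of 1 2] uniq[of 1 3] uniq[of 2 3] by simp blast
qed

lemma K24_minor_free_double_fan: "K24_minor_free (double_fan lo k hi)"
proof (rule ccontr)
  assume "\<not> ?thesis"
  then obtain A B and C :: "nat \<Rightarrow> _" where A: "connected_in (double_fan lo k hi) A"
    and B: "connected_in (double_fan lo k hi) B" and AB: "A \<inter> B = {}"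
    and C: "\<forall>i<4. connected_in (double_fan lo k hi) (C i) \<and> C i \<inter> A = {} \<and> C i \<inter> B = {} \<and>
         touches (double_fan lo k hi) (C i) A \<and> touches (double_fan lo k hi) (C i) B"
    and CC: "\<forall>i<4. \<forall>j<4. i \<noteq> j \<longrightarrow> C i \<inter> C j = {}"
    by (rule K24_minorE)
  have BA: "B \<inter> A = {}" using AB by blast
  have C': "\<forall>i<4. connected_in (double_fan lo k hi) (C i) \<and> C i \<inter> B = {} \<and> C i \<inter> A = {} \<and>
         touches (double_fan lo k hi) (C i) B \<and> touches (double_fan lo k hi) (C i) A"
    using C by simp
  show False
    using double_fan_hub[OF A B AB C CC] double_fan_hub[OF B A BA C' CC]
      double_fan_no_four[OF A B AB C CC] double_fan_no_four[OF B A BA C' CC] AB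
    by blast
qed

end

section \<open>Subdivisions\<close>

lemma verts_subdivide [simp]: "verts (subdivide G F) = Inl ` verts G \<union> Inr ` F"
  by (simp add: subdivide_def)

lemma adj_subdivide [simp]:
  "adj (subdivide G F) (Inl u) (Inl v) \<longleftrightarrow> adj G u v \<and> {u, v} \<notin> F"
  "adj (subdivide G F) (Inl u) (Inr e) \<longleftrightarrow> e \<in> F \<and> u \<in> e"
  "adj (subdivide G F) (Inr e) (Inl u) \<longleftrightarrow> e \<in> F \<and> u \<in> e"
  "\<not> adj (subdivide G F) (Inr e) (Inr e')"
proof -
  have Inl: "{Inl u, Inl v} = Inl ` e \<longleftrightarrow> e = {u, v}" for e :: "'a set"
  proof -
    have "{Inl u, Inl v} = Inl ` {u, v}" by simp
    then show ?thesis using inj_image_eq_iff[OF inj_Inl, of "{u, v}" e] by auto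
  qed
  have "{Inl u, Inl v} \<in> image Inl ` (edges G - F) \<longleftrightarrow> {u, v} \<in> edges G - F"
    by (simp only: image_iff Inl) simp
  then show "adj (subdivide G F) (Inl u) (Inl v) \<longleftrightarrow> adj G u v \<and> {u, v} \<notin> F"
    by (auto simp: adj_def subdivide_def doubleton_eq_iff)
  show *: "adj (subdivide G F) (Inl u) (Inr e) \<longleftrightarrow> e \<in> F \<and> u \<in> e"
    by (auto simp: adj_def subdivide_def doubleton_eq_iff)
  then show "adj (subdivide G F) (Inr e) (Inl u) \<longleftrightarrow> e \<in> F \<and> u \<in> e"
    by (simp add: adj_commute)
  show "\<not> adj (subdivide G F) (Inr e) (Inr e')"
    by (auto simp: adj_def subdivide_def doubleton_eq_iff)
qed

text \<open>\<open>S\<close> claims the subdividing vertices of its inner edges and of its edges to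
  the region \<open>X\<close>. A hub takes \<open>X = {}\<close>, any other branch set takes
  \<open>X = A \<union> B\<close>; the vertices on edges between the two hubs then remain unclaimed
  and can be branch sets themselves.\<close>

definition lift_set :: "'v set set \<Rightarrow> 'v set \<Rightarrow> 'v set \<Rightarrow> ('v + 'v set) set" where
  "lift_set F X S = Inl ` S \<union> Inr ` {e \<in> F. e \<inter> S \<noteq> {} \<and> e \<subseteq> S \<union> X}"

text \<open>A path in \<open>S\<close> lifts edge by edge, with a detour through the new vertex if
  the edge is in \<open>F\<close>; every other claimed vertex hangs on a vertex of
  \<open>S\<close>.\<close>

lemma connected_in_lift_set:
  assumes "connected_in G S"
  shows "connected_in (subdivide G F) (lift_set F X S)"
proof -
  let ?T = "lift_set F X S" and ?H = "subdivide G F"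
  let ?R = "\<lambda>u v. u \<in> ?T \<and> v \<in> ?T \<and> adj ?H u v"
  obtain c where c: "c \<in> S" using assms by (auto simp: connected_in_iff)
  have reach: "?R\<^sup>*\<^sup>* (Inl c) (Inl v)" if "v \<in> S" for v
  proof -
    have "(\<lambda>u v. u \<in> S \<and> v \<in> S \<and> adj G u v)\<^sup>*\<^sup>* c v"
      using assms c that by (simp add: connected_in_iff)
    then show ?thesis
    proof (induction rule: rtranclp_induct)
      case (step y z)
      show ?case
      proof (cases "{y, z} \<in> F")
        case True
        then have "?R (Inl y) (Inr {y, z})" "?R (Inr {y, z}) (Inl z)"
          using step.hyps by (auto simp: lift_set_def)
        from rtranclp.rtrancl_into_rtrancl[OF rtranclp.rtrancl_into_rtrancl[OF step.IH this(1)] this(2)]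
        show ?thesis .
      next
        case False
        then have "?R (Inl y) (Inl z)" using step.hyps by (auto simp: lift_set_def)
        with step.IH show ?thesis by (rule rtranclp.rtrancl_into_rtrancl)
      qed
    qed simp
  qed
  have "?R\<^sup>*\<^sup>* (Inl c) w" if w: "w \<in> ?T" for w
  proof (cases w)
    case (Inl v)
    with w have "v \<in> S" by (auto simp: lift_set_def)
    then show ?thesis unfolding Inl by (rule reach)
  next
    case (Inr e)
    with w obtain x where x: "x \<in> e" "x \<in> S" "e \<in> F" by (auto simp: lift_set_def)
    then have "?R (Inl x) w" using w Inr by (auto simp: lift_set_def)
    with reach[OF x(2)] show ?thesis by (rule rtranclp.rtrancl_into_rtrancl)
  qed
  moreover have "?T \<subseteq> verts ?H" "Inl c \<in> ?T"
    using assms c by (auto simp: lift_set_def connected_in_def)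
  ultimately show ?thesis by (rule_tac connected_inI)
qed

text \<open>If the touching edge is subdivided, its new vertex is claimed by the lift of
  \<open>C\<close>, because \<open>A\<close> lies in \<open>X\<close>, and it is adjacent to the end
  in \<open>A\<close>.\<close>

lemma touches_lift_set:
  assumes "touches G C A" "A \<subseteq> X"
  shows "touches (subdivide G F) (lift_set F X C) (lift_set F Y A)"
proof -
  obtain u v where uv: "u \<in> C" "v \<in> A" "adj G u v"
    using assms(1) unfolding touches_def by blast
  have v: "Inl v \<in> lift_set F Y A" using uv by (simp add: lift_set_def)
  show ?thesis
  proof (cases "{u, v} \<in> F")
    case True
    then have "Inr {u, v} \<in> lift_set F X C" "adj (subdivide G F) (Inr {u, v}) (Inl v)"
      using uv assms(2) by (auto simp: lift_set_def)
    with v show ?thesis unfolding touches_def by blast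
  next
    case False
    then have "Inl u \<in> lift_set F X C" "adj (subdivide G F) (Inl u) (Inl v)"
      using uv by (auto simp: lift_set_def)
    with v show ?thesis unfolding touches_def by blast
  qed
qed

text \<open>In a subdivision, each subdivided edge between the hubs \<open>A\<close> and \<open>B\<close> provides one of the
  four branch sets adjacent to both.\<close>

lemma not_subdividableI:
  assumes A: "connected_in G A" and B: "connected_in G B" and AB: "A \<inter> B = {}"
    and len: "length es + length Cs = 4"
    and es: "set es \<subseteq> F" "distinct es" "\<forall>e \<in> set es. \<exists>a \<in> A. \<exists>b \<in> B. e = {a, b}"
    and Cs: "\<forall>C \<in> set Cs. connected_in G C \<and> C \<inter> A = {} \<and> C \<inter> B = {} \<and>
               touches G C A \<and> touches G C B"
      "sorted_wrt (\<lambda>C C'. C \<inter> C' = {}) Cs"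
  shows "\<not> subdividable G F"
proof -
  let ?H = "subdivide G F"
  define lift where "lift = lift_set F (A \<union> B)"
  define A' where "A' = lift_set F {} A"
  define B' where "B' = lift_set F {} B"
  define L where "L = map (\<lambda>e. {Inr e}) es @ map lift Cs"
  have "connected_in ?H X \<and> X \<inter> A' = {} \<and> X \<inter> B' = {} \<and> touches ?H X A' \<and> touches ?H X B'"
    if "X \<in> set L" for X
  proof -
    from that consider e where "e \<in> set es" "X = {Inr e}" | C where "C \<in> set Cs" "X = lift C"
      unfolding L_def by auto
    then show ?thesis
    proof cases
      case 1
      then obtain a b where ab: "a \<in> A" "b \<in> B" "e = {a, b}" "e \<in> F" using es by blast
      moreover have "a \<notin> B" "b \<notin> A" using AB ab by auto
      moreover have "Inl a \<in> A'" "Inl b \<in> B'" using ab by (simp_all add: A'_def B'_def lift_set_def)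
      then have "touches ?H X A'" "touches ?H X B'"
        using ab 1 unfolding touches_def by (auto intro: bexI[of _ "Inl a"] bexI[of _ "Inl b"])
      ultimately show ?thesis
        using 1 by (auto simp: A'_def B'_def lift_set_def connected_in_singleton)
    next
      case 2
      then have C: "connected_in G C" "C \<inter> A = {}" "C \<inter> B = {}" "touches G C A" "touches G C B"
        using Cs(1) by auto
      have "lift C \<inter> A' = {}" "lift C \<inter> B' = {}"
        using C(2,3) by (auto simp: lift_def A'_def B'_def lift_set_def)
      then show ?thesis
        using 2 C connected_in_lift_set touches_lift_set[of G C _ "A \<union> B"]
        by (simp add: lift_def A'_def B'_def)
    qed
  qed
  moreover have sorted: "sorted_wrt (\<lambda>X Y. X \<inter> Y = {}) L"
  proof -
    have "sorted_wrt (\<lambda>e e'. e \<noteq> e') es" using es(2) by (simp add: distinct_conv_nth sorted_wrt_iff_nth_less)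
    moreover have "lift C \<inter> lift C' = {}" if "C \<in> set Cs" "C' \<in> set Cs" "C \<inter> C' = {}" for C C'
    proof -
      have "C \<inter> (A \<union> B) = {}" "C' \<inter> (A \<union> B) = {}" using that Cs(1) by auto
      with that(3) show ?thesis by (auto simp: lift_def lift_set_def)
    qed
    moreover have "Inr e \<notin> lift C" if "e \<in> set es" "C \<in> set Cs" for e C
    proof -
      have "e \<subseteq> A \<union> B" using es(3) that(1) by auto
      moreover have "C \<inter> (A \<union> B) = {}" using that Cs(1) by auto
      ultimately show ?thesis by (auto simp: lift_def lift_set_def)
    qed
    ultimately show ?thesis
      using Cs(2) by (auto simp: L_def sorted_wrt_append sorted_wrt_map elim!: sorted_wrt_mono_rel[rotated])
  qed
  moreover have L4: "length L = 4" using len by (simp add: L_def)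
  moreover have "connected_in ?H A'" "connected_in ?H B'"
    using A B by (simp_all add: A'_def B'_def connected_in_lift_set)
  moreover have "A' \<inter> B' = {}" using AB by (auto simp: A'_def B'_def lift_set_def)
  moreover have "L ! i \<inter> L ! j = {}" if "i < j" "j < 4" for i j
    using sorted_wrt_nth_less[OF sorted that(1)] that(2) L4 by simp
  ultimately have "\<not> K24_minor_free ?H"
    by (intro K24_minorI[of _ A' B' "\<lambda>i. L ! i"]) simp_all
  then show ?thesis by (simp add: subdividable_def)
qed

text \<open>A maximal set lies below some member and so equals it. A subdividable set above a member
  lies below another member, and the antichain condition collapses this chain.\<close>

lemma maximal_subdividable_eqI:
  assumes "\<And>S. S \<in> \<S> \<Longrightarrow> subdividable G S"
    and "\<And>F. subdividable G F \<Longrightarrow> \<exists>S\<in>\<S>. F \<subseteq> S"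
    and "\<And>S T. S \<in> \<S> \<Longrightarrow> T \<in> \<S> \<Longrightarrow> S \<subseteq> T \<Longrightarrow> S = T"
  shows "{F. maximal_subdividable G F} = \<S>"
proof (intro set_eqI iffI)
  fix F assume "F \<in> {F. maximal_subdividable G F}"
  then have F: "subdividable G F" "\<And>F'. subdividable G F' \<Longrightarrow> F \<subseteq> F' \<Longrightarrow> F' = F"
    by (auto simp: maximal_subdividable_def)
  from assms(2)[OF F(1)] obtain S where "S \<in> \<S>" "F \<subseteq> S" by blast
  with F(2)[OF assms(1)] show "F \<in> \<S>" by metis
next
  fix F assume F: "F \<in> \<S>"
  have "F' = F" if "subdividable G F'" "F \<subseteq> F'" for F'
  proof -
    from assms(2)[OF that(1)] obtain S where "S \<in> \<S>" "F' \<subseteq> S" by blast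
    moreover from this have "F = S" using that(2) F by (intro assms(3)) auto
    ultimately show ?thesis using that(2) by auto
  qed
  with assms(1)[OF F] show "F \<in> {F. maximal_subdividable G F}"
    by (simp add: maximal_subdividable_def)
qed

lemma connected_in_interval:
  fixes G :: "nat graph"
  assumes "a \<le> b" "{a..b} \<subseteq> verts G" "\<And>i. a \<le> i \<Longrightarrow> i < b \<Longrightarrow> adj G i (Suc i)"
  shows "connected_in G {a..b}"
  using assms
proof (induction b rule: dec_induct)
  case base
  then show ?case by (simp add: connected_in_singleton)
next
  case (step m)
  have "{a..m} \<subseteq> verts G" "Suc m \<in> verts G" "adj G m (Suc m)"
    using step by auto
  moreover from this step have "connected_in G {a..m}" by simp
  ultimately have "connected_in G (insert (Suc m) {a..m})"
    using step.hyps by (intro connected_in_insert[of G _ _ m]) auto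
  then show ?case using step.hyps by (simp add: atLeastAtMostSuc_conv)
qed

text \<open>Deleting \<open>x\<close> and \<open>y\<close> cuts \<open>v\<close> off from
  \<open>w\<close>.\<close>

lemma not_3_connected_if_degree_2:
  assumes "v \<in> verts G" "w \<in> verts G" "w \<noteq> v" "w \<notin> {x, y}" "v \<notin> {x, y}"
    and "{x, y} \<subseteq> verts G" "\<And>u. adj G v u \<Longrightarrow> u \<in> {x, y}"
  shows "\<not> k_connected 3 G"
proof
  assume "k_connected 3 G"
  moreover have "card {x, y} < 3" by (simp add: card_insert_if)
  ultimately have "connected_graph (induced G (verts G - {x, y}))"
    using assms(6) unfolding k_connected_def by blast
  then have "connected_in G (verts G - {x, y})" by (simp add: connected_in_def)
  then obtain u where "u \<in> verts G - {x, y}" "adj G v u"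
    by (rule connected_in_exit[of _ _ v "\<lambda>u. u = v" w]) (use assms in auto)
  then show False using assms(7) by blast
qed

text \<open>Doubling all positions makes room for the subdividing vertices between consecutive ones.\<close>

lemma subdividable_double_fanI:
  fixes pos :: "'v \<Rightarrow> nat"
  assumes k: "lo < k" "k < hi" and inj: "inj_on pos (verts G)" and ran: "pos ` verts G \<subseteq> {lo..hi}"
    and F: "F \<subseteq> edges G"
      "\<And>e. e \<in> F \<Longrightarrow> \<exists>u\<in>verts G. \<exists>v\<in>verts G. e = {u, v} \<and> pos v = Suc (pos u)"
    and simple: "\<And>v. \<not> adj G v v"
    and E: "\<And>u v. adj G u v \<Longrightarrow> {u, v} \<notin> F \<Longrightarrow> pos u < pos v \<Longrightarrow>
              pos u = lo \<and> k \<le> pos v \<or> pos v = hi \<and> pos u \<le> k"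
  shows "subdividable G F"
  unfolding subdividable_def
proof
  \<comment> \<open>On an edge \<open>{u, v}\<close> with consecutive positions,
    \<open>sum pos\<close> is \<open>pos u + pos v = 2 * pos u + 1\<close>, the number between the
    two doubled positions.\<close>
  define f where "f = case_sum (\<lambda>v. 2 * pos v) (sum pos)"
  have f_Inl: "f (Inl v) = 2 * pos v" for v by (simp add: f_def)
  have f_Inr: "\<exists>u\<in>verts G. \<exists>v\<in>verts G. e = {u, v} \<and> pos v = Suc (pos u) \<and> f (Inr e) = Suc (2 * pos u)"
    if "e \<in> F" for e
  proof -
    from F(2)[OF that] obtain u v where "u \<in> verts G" "v \<in> verts G" "e = {u, v}" "pos v = Suc (pos u)"
      by blast
    moreover from this have "u \<noteq> v" by auto
    ultimately show ?thesis by (intro bexI[of _ u] bexI[of _ v]) (simp_all add: f_def)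
  qed
  show "K24_minor_free (subdivide G F)"
  proof (rule K24_minor_free_embedding)
    show "K24_minor_free (double_fan (2 * lo) (2 * k) (2 * hi))"
      using k by (intro K24_minor_free_double_fan) auto
    show "inj_on f (verts (subdivide G F))"
    proof (rule inj_onI)
      fix x y assume "x \<in> verts (subdivide G F)" "y \<in> verts (subdivide G F)" and eq: "f x = f y"
      then consider u v where "x = Inl u" "y = Inl v" "u \<in> verts G" "v \<in> verts G"
        | u e where "x = Inl u" "y = Inr e" "e \<in> F" | u e where "x = Inr e" "y = Inl u" "e \<in> F"
        | e e' where "x = Inr e" "y = Inr e'" "e \<in> F" "e' \<in> F"
        unfolding verts_subdivide by blast
      then show "x = y"
      proof cases
        case 1
        with eq inj_onD[OF inj] show ?thesis by (simp add: f_Inl)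
      next
        case 2
        with f_Inr[of e] obtain a where "f (Inr e) = Suc (2 * pos a)" by blast
        then have "Suc (2 * pos a) = 2 * pos u" using eq 2 by (simp add: f_Inl)
        then have False by presburger
        then show ?thesis by simp
      next
        case 3
        with f_Inr[of e] obtain a where "f (Inr e) = Suc (2 * pos a)" by blast
        then have "Suc (2 * pos a) = 2 * pos u" using eq 3 by (simp add: f_Inl)
        then have False by presburger
        then show ?thesis by simp
      next
        case 4
        from f_Inr[OF 4(3)] obtain u v where uv: "u \<in> verts G" "v \<in> verts G" "e = {u, v}"
          "pos v = Suc (pos u)" "f (Inr e) = Suc (2 * pos u)" by blast
        from f_Inr[OF 4(4)] obtain u' v' where uv': "u' \<in> verts G" "v' \<in> verts G" "e' = {u', v'}"
          "pos v' = Suc (pos u')" "f (Inr e') = Suc (2 * pos u')" by blast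
        have "pos u = pos u'" "pos v = pos v'" using uv(4,5) uv'(4,5) eq 4(1,2) by simp_all
        then have "u = u'" "v = v'" using inj_onD[OF inj] uv(1,2) uv'(1,2) by blast+
        with uv(3) uv'(3) 4(1,2) show ?thesis by simp
      qed
    qed
    show "f ` verts (subdivide G F) \<subseteq> verts (double_fan (2 * lo) (2 * k) (2 * hi))"
    proof
      fix y assume "y \<in> f ` verts (subdivide G F)"
      then consider v where "v \<in> verts G" "y = f (Inl v)" | e where "e \<in> F" "y = f (Inr e)"
        unfolding verts_subdivide by blast
      then show "y \<in> verts (double_fan (2 * lo) (2 * k) (2 * hi))"
      proof cases
        case 1
        with ran show ?thesis by (auto simp: f_Inl)
      next
        case 2
        from f_Inr[OF 2(1)] obtain u v where uv: "u \<in> verts G" "v \<in> verts G"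
          "pos v = Suc (pos u)" "f (Inr e) = Suc (2 * pos u)" by blast
        then have "lo \<le> pos u" "pos v \<le> hi" using ran by auto
        with uv(3,4) 2(2) show ?thesis by simp
      qed
    qed
    have half: "fan_edge (2 * lo) (2 * k) (2 * hi) (2 * pos u) (f (Inr e))
        \<or> fan_edge (2 * lo) (2 * k) (2 * hi) (f (Inr e)) (2 * pos u)" if "e \<in> F" "u \<in> e" for u e
    proof -
      from f_Inr[OF that(1)] obtain a b where ab: "a \<in> verts G" "b \<in> verts G" "e = {a, b}"
        "pos b = Suc (pos a)" "f (Inr e) = Suc (2 * pos a)" by blast
      then have "lo \<le> pos a" "pos b \<le> hi" using ran by auto
      moreover have "u = a \<or> u = b" using that(2) ab(3) by simp
      ultimately show ?thesis using ab(4,5) by (elim disjE) (simp_all add: fan_edge_def)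
    qed
    fix x y
    assume xy: "x \<in> verts (subdivide G F)" "y \<in> verts (subdivide G F)" "adj (subdivide G F) x y"
    show "adj (double_fan (2 * lo) (2 * k) (2 * hi)) (f x) (f y)"
    proof (cases x y rule: sum.exhaust[case_product sum.exhaust])
      \<comment> \<open>Doubled positions are never consecutive, so an edge outside \<open>F\<close>
        must become a fan edge even if its ends have consecutive positions.\<close>
      fix u v assume [simp]: "x = Inl u" "y = Inl v"
      have uv: "adj G u v" "{u, v} \<notin> F" "u \<in> verts G" "v \<in> verts G" using xy by auto
      have rng: "lo \<le> pos u" "pos u \<le> hi" "lo \<le> pos v" "pos v \<le> hi" using ran uv by auto
      have "u \<noteq> v" using simple uv(1) by metis
      then have "pos u \<noteq> pos v" using inj_onD[OF inj _ uv(3,4)] by metis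
      then consider "pos u < pos v" | "pos v < pos u" by linarith
      then show ?thesis
      proof cases
        case 1
        with E[OF uv(1,2)] rng show ?thesis by (auto simp: adj_double_fan fan_edge_def f_Inl)
      next
        case 2
        have "adj G v u" "{v, u} \<notin> F" using uv by (simp_all add: adj_commute insert_commute)
        from E[OF this 2] 2 rng show ?thesis by (auto simp: adj_double_fan fan_edge_def f_Inl)
      qed
    next
      fix u e assume "x = Inl u" "y = Inr e"
      then show ?thesis using xy(3) half[of e u] by (simp add: adj_double_fan f_Inl)
    next
      fix u e assume "x = Inr e" "y = Inl u"
      then show ?thesis using xy(3) half[of e u] by (simp add: adj_double_fan f_Inl) blast
    next
      fix e e' assume "x = Inr e" "y = Inr e'"
      then show ?thesis using xy(3) by simp
    qed
  qed
qed (rule F)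

section \<open>The graphs with a spine\<close>

text \<open>Lets \<open>not_subdividableI\<close>, used with no subdivided edges and four branch
  sets, refute K24-freeness of \<open>G\<close> itself.\<close>

lemma subdividable_empty: "K24_minor_free G \<Longrightarrow> subdividable G {}"
  unfolding subdividable_def
proof
  assume G: "K24_minor_free G"
  show "K24_minor_free (subdivide G {})"
    \<comment> \<open>The value on \<open>Inr\<close> is arbitrary: there are no subdividing
      vertices.\<close>
    by (rule K24_minor_free_embedding[OF G, of "case_sum id (\<lambda>_. undefined)"])
      (auto simp: inj_on_def)
qed simp

section \<open>Edge sets of walks\<close>

lemma walk_edges_Cons:
  "xs \<noteq> [] \<Longrightarrow> walk_edges (x # xs) = insert {x, hd xs} (walk_edges xs)"
proof -
  assume "xs \<noteq> []"
  have "e \<in> walk_edges (x # xs) \<longleftrightarrow> e = {x, hd xs} \<or> e \<in> walk_edges xs" for e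
  proof
    assume "e \<in> walk_edges (x # xs)"
    then obtain i where i: "i < length xs" "e = {(x # xs) ! i, xs ! i}"
      by (auto simp: walk_edges_def)
    show "e = {x, hd xs} \<or> e \<in> walk_edges xs"
    proof (cases i)
      case 0
      with i \<open>xs \<noteq> []\<close> show ?thesis by (simp add: hd_conv_nth)
    next
      case (Suc j)
      with i have "e = {xs ! j, xs ! Suc j}" "Suc j < length xs" by simp_all
      then show ?thesis unfolding walk_edges_def by blast
    qed
  next
    assume "e = {x, hd xs} \<or> e \<in> walk_edges xs"
    then show "e \<in> walk_edges (x # xs)"
    proof
      assume "e = {x, hd xs}"
      with \<open>xs \<noteq> []\<close> have "e = {(x # xs) ! 0, (x # xs) ! Suc 0}" "Suc 0 < length (x # xs)"
        by (simp_all add: hd_conv_nth)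
      then show ?thesis unfolding walk_edges_def by blast
    next
      assume "e \<in> walk_edges xs"
      then obtain i where "Suc i < length xs" "e = {xs ! i, xs ! Suc i}"
        by (auto simp: walk_edges_def)
      then have "Suc (Suc i) < length (x # xs)" "e = {(x # xs) ! Suc i, (x # xs) ! Suc (Suc i)}"
        by simp_all
      then show ?thesis unfolding walk_edges_def by blast
    qed
  qed
  then show ?thesis by blast
qed

lemma walk_edges_snoc:
  "xs \<noteq> [] \<Longrightarrow> walk_edges (xs @ [y]) = insert {last xs, y} (walk_edges xs)"
proof (induction xs rule: list_nonempty_induct)
  case (single x)
  then show ?case by (auto simp: walk_edges_def)
next
  case (cons x xs)
  then show ?case by (simp add: walk_edges_Cons insert_commute)
qed

lemma walk_edges_rev: "walk_edges (rev xs) = walk_edges xs"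
proof (induction xs)
  case (Cons x xs)
  then show ?case
    by (cases "xs = []") (simp_all add: walk_edges_Cons walk_edges_snoc last_rev insert_commute)
qed simp

lemma walk_edges_upt: "walk_edges [a..<b] = {{i, Suc i} | i. a \<le> i \<and> Suc i < b}"
proof -
  have "e \<in> walk_edges [a..<b] \<longleftrightarrow> (\<exists>i. e = {i, Suc i} \<and> a \<le> i \<and> Suc i < b)" for e
  proof
    assume "e \<in> walk_edges [a..<b]"
    then obtain i where "Suc i < b - a" "e = {a + i, Suc (a + i)}"
      by (auto simp: walk_edges_def)
    then show "\<exists>i. e = {i, Suc i} \<and> a \<le> i \<and> Suc i < b"
      by (intro exI[of _ "a + i"]) auto
  next
    assume "\<exists>i. e = {i, Suc i} \<and> a \<le> i \<and> Suc i < b"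
    then obtain i where "e = {i, Suc i}" "a \<le> i" "Suc i < b" by blast
    then have "e = {[a..<b] ! (i - a), [a..<b] ! Suc (i - a)}" "Suc (i - a) < length [a..<b]"
      by auto
    then show "e \<in> walk_edges [a..<b]" unfolding walk_edges_def by blast
  qed
  then show ?thesis by blast
qed

lemma spine_eq: "spine n = {{i, Suc i} | i. 1 \<le> i \<and> i < n}"
  using walk_edges_upt[of 1 "n + 1"] by (simp only: spine_def Suc_eq_plus1[symmetric] Suc_less_eq)

lemma spine_iff: "u < v \<Longrightarrow> {u, v} \<in> spine n \<longleftrightarrow> v = Suc u \<and> 1 \<le> u \<and> u < n"
  by (auto simp: spine_eq doubleton_eq_iff)

lemma touchesI: "u \<in> S \<Longrightarrow> v \<in> T \<Longrightarrow> adj G u v \<Longrightarrow> touches G S T"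
  unfolding touches_def by blast

text \<open>One description of both families, the flag \<open>p\<close> switching on v_1 v_n. The
  other chords v_1 v_(n-i) and v_n v_(1+j) become ranges for the end that varies.\<close>

definition path_edge :: "bool \<Rightarrow> nat \<Rightarrow> nat \<Rightarrow> nat \<Rightarrow> nat \<Rightarrow> nat \<Rightarrow> bool" where
  "path_edge p n r s u v \<longleftrightarrow> 1 \<le> u \<and> u < v \<and> v \<le> n \<and>
     (v = Suc u \<or> u = 1 \<and> n - r \<le> v \<and> v < n \<or> v = n \<and> 2 \<le> u \<and> u \<le> Suc s \<or> p \<and> u = 1 \<and> v = n)"

locale spine_graph =
  fixes p :: bool and n r s :: nat and G :: "nat graph"
  assumes n: "6 \<le> n" and r: "r \<le> n - 3" and s: "s \<le> n - 3"
    and G: "G = (if p then Gplus_graph n r s else G_graph n r s)"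
begin

abbreviation E :: "nat \<Rightarrow> nat \<Rightarrow> bool" where
  "E \<equiv> path_edge p n r s"

lemma verts_G [simp]: "verts G = {1..n}"
  by (simp add: G G_graph_def Gplus_graph_def)

lemma edges_G: "edges G = {{u, v} | u v. E u v}"
proof -
  have *: "edges G = spine n \<union> {{1, n - i} | i. 1 \<le> i \<and> i \<le> r} \<union> {{n, 1 + j} | j. 1 \<le> j \<and> j \<le> s}
      \<union> (if p then {{1, n}} else {})"
    by (auto simp: G G_graph_def Gplus_graph_def)
  have "e \<in> edges G \<longleftrightarrow> (\<exists>u v. e = {u, v} \<and> E u v)" for e
  proof
    assume "e \<in> edges G"
    then consider i where "e = {i, Suc i}" "1 \<le> i" "i < n" | i where "e = {1, n - i}" "1 \<le> i" "i \<le> r"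
      | j where "e = {1 + j, n}" "1 \<le> j" "j \<le> s" | "e = {1, n}" "p"
      unfolding * spine_eq by (auto split: if_splits simp: insert_commute)
    then show "\<exists>u v. e = {u, v} \<and> E u v"
    proof cases
      case (1 i)
      then show ?thesis by (intro exI[of _ i] exI[of _ "Suc i"]) (simp add: path_edge_def)
    next
      case (2 i)
      then show ?thesis using n r
        by (intro exI[of _ 1] exI[of _ "n - i"] conjI) (simp_all add: path_edge_def, linarith)
    next
      case (3 j)
      then show ?thesis using n s
        by (intro exI[of _ "1 + j"] exI[of _ n] conjI) (simp_all add: path_edge_def)
    next
      case 4
      then show ?thesis using n
        by (intro exI[of _ 1] exI[of _ n] conjI) (simp_all add: path_edge_def)
    qed
  next
    assume "\<exists>u v. e = {u, v} \<and> E u v"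
    then obtain u v where e: "e = {u, v}" "1 \<le> u" "u < v" "v \<le> n" and
      "v = Suc u \<or> u = 1 \<and> n - r \<le> v \<and> v < n \<or> v = n \<and> 2 \<le> u \<and> u \<le> Suc s \<or> p \<and> u = 1 \<and> v = n"
      unfolding path_edge_def by blast
    then consider "v = Suc u" | "u = 1" "n - r \<le> v" "v < n" | "v = n" "2 \<le> u" "u \<le> Suc s"
      | "p" "u = 1" "v = n" by blast
    then show "e \<in> edges G"
    proof cases
      case 1
      with e have "e \<in> spine n" by (simp add: spine_iff)
      then show ?thesis by (simp add: *)
    next
      case 2
      with e have "e = {1, n - (n - v)}" "1 \<le> n - v" "n - v \<le> r" by auto
      then show ?thesis unfolding * by blast
    next
      case 3
      with e have "e = {n, 1 + (u - 1)}" "1 \<le> u - 1" "u - 1 \<le> s" by auto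
      then show ?thesis unfolding * by blast
    next
      case 4
      with e show ?thesis by (simp add: *)
    qed
  qed
  then show ?thesis by blast
qed

lemma adj_G: "adj G u v \<longleftrightarrow> E u v \<or> E v u"
proof -
  have "adj G u v \<longleftrightarrow> (\<exists>a b. {u, v} = {a, b} \<and> E a b)"
    unfolding adj_def edges_G mem_Collect_eq by blast
  also have "\<dots> \<longleftrightarrow> E u v \<or> E v u" unfolding doubleton_eq_iff by blast
  finally show ?thesis .
qed

lemma adj_spine: "1 \<le> i \<Longrightarrow> i < n \<Longrightarrow> adj G i (Suc i)"
  by (simp add: adj_G path_edge_def)

lemma connected_in_segment: "1 \<le> a \<Longrightarrow> a \<le> b \<Longrightarrow> b \<le> n \<Longrightarrow> connected_in G {a..b}"
  by (rule connected_in_interval) (auto intro: adj_spine)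

lemma connected_in_edge:
  assumes "u \<in> {1..n}" "v \<in> {1..n}" "adj G u v"
  shows "connected_in G {u, v}"
  using connected_in_insert[OF connected_in_singleton[of v G] _ _ assms(3)[unfolded adj_commute[of G u v]]]
    assms by simp

text \<open>Otherwise both chord ranges contain \<open>n - r\<close> and \<open>n - r + 1\<close>.
  From \<open>s \<le> n - 3\<close> one gets \<open>3 \<le> r\<close>, which separates these two
  from \<open>n - 1\<close>, while \<open>r \<le> n - 3\<close> separates them from 2.\<close>

lemma r_plus_s:
  assumes "K24_minor_free G" "r \<le> s"
  shows "r + s \<le> n - 1"
proof (rule ccontr)
  assume "\<not> ?thesis"
  then have rs: "n \<le> r + s" by simp
  then have r3: "3 \<le> r" using n s by linarith
  have "\<not> subdividable G {}"
  proof (rule not_subdividableI[of G "{1}" "{n}" "[]" "[{2}, {n-r}, {n-r+1}, {n-1}]"])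
    have "adj G i 1" "adj G i n" if "i = 2 \<or> i = n - r \<or> i = n - r + 1 \<or> i = n - 1" for i
    proof -
      show "adj G i 1" using that r3 r n by (auto simp: adj_G path_edge_def)
      have "i = n - 1 \<or> 2 \<le> i \<and> i \<le> Suc s" using that rs r r3 s n by linarith
      then show "adj G i n" using n s by (auto simp: adj_G path_edge_def)
    qed
    note adj = this
    have "1 < i \<and> i < n" if "i = 2 \<or> i = n - r \<or> i = n - r + 1 \<or> i = n - 1" for i
      using that r3 r n by linarith
    note bounds = this
    show "\<forall>C\<in>set [{2}, {n-r}, {n-r+1}, {n-1}]. connected_in G C \<and> C \<inter> {1} = {} \<and>
        C \<inter> {n} = {} \<and> touches G C {1} \<and> touches G C {n}"
    proof
      fix C assume "C \<in> set [{2}, {n-r}, {n-r+1}, {n-1}]"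
      then obtain i where i: "C = {i}" "i = 2 \<or> i = n - r \<or> i = n - r + 1 \<or> i = n - 1"
        unfolding set_simps by blast
      from adj[OF i(2)] bounds[OF i(2)] show "connected_in G C \<and> C \<inter> {1} = {} \<and>
          C \<inter> {n} = {} \<and> touches G C {1} \<and> touches G C {n}"
        by (simp add: i(1) touches_def connected_in_singleton)
    qed
    show "sorted_wrt (\<lambda>C C'. C \<inter> C' = {}) [{2}, {n-r}, {n-r+1}, {n-1}]"
    proof -
      have "n - r \<noteq> 2" "n - r + 1 \<noteq> 2" "n - 1 \<noteq> 2" "n - r \<noteq> n - 1" "n - r + 1 \<noteq> n - 1"
        using n r r3 by linarith+
      then show ?thesis by simp
    qed
  qed (use n in \<open>auto simp: connected_in_singleton\<close>)
  with subdividable_empty[OF assms(1)] show False by simp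
qed

text \<open>Otherwise v_(s+2) comes after the chords of v_n and before those of v_1, so it has
  degree 2.\<close>

lemma r_plus_s_ge:
  assumes "k_connected 3 G" "1 \<le> r" "r \<le> s"
  shows "n - 2 \<le> r + s"
proof (rule ccontr)
  assume "\<not> ?thesis"
  then have "2 + s < n - r" by linarith
  then have "\<not> k_connected 3 G"
    using n s assms(2,3)
    by (intro not_3_connected_if_degree_2[of "2 + s" G n "1 + s" "3 + s"])
      (auto simp: adj_G path_edge_def)
  with assms(1) show False by simp
qed

text \<open>The bound on r + s gives s = n - 3, and without v_1 v_n the vertex v_1 would have only
  the neighbours v_2 and v_(n-1).\<close>

lemma r_1_imp_wheel:
  assumes "k_connected 3 G" "r = 1" "r \<le> s"
  shows "G = wheel n"
proof -
  have s_eq: "s = n - 3" using r_plus_s_ge[OF assms(1) _ assms(3)] assms(2) s n by linarith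
  have "p"
  proof (rule ccontr)
    assume "\<not> p"
    then have "\<not> k_connected 3 G"
      using n assms(2)
      by (intro not_3_connected_if_degree_2[of 1 G 3 2 "n - 1"]) (auto simp: adj_G path_edge_def)
    with assms(1) show False by simp
  qed
  with s_eq assms(2) show ?thesis by (simp add: G wheel_def)
qed

text \<open>Positions are the indices themselves and \<open>k = n - r\<close>: the chords of v_1
  start there, and those of v_n stop at \<open>s + 1 \<le> n - r\<close>.\<close>

lemma subdividable_spine:
  assumes "1 \<le> r" "r + s \<le> n - 1"
  shows "subdividable G (spine n)"
proof (rule subdividable_double_fanI[of 1 "n - r" n id])
  show "spine n \<subseteq> edges G" unfolding spine_eq using adj_spine by (auto simp: adj_def)
  show "\<exists>u\<in>verts G. \<exists>v\<in>verts G. e = {u, v} \<and> id v = Suc (id u)" if e: "e \<in> spine n" for e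
  proof -
    from e obtain i where "e = {i, Suc i}" "1 \<le> i" "i < n" unfolding spine_eq by blast
    then show ?thesis by (intro bexI[of _ i] bexI[of _ "Suc i"]) simp_all
  qed
  show "\<not> adj G v v" for v by (simp add: adj_G path_edge_def)
  show "id u = 1 \<and> n - r \<le> id v \<or> id v = n \<and> id u \<le> n - r"
    if "adj G u v" "{u, v} \<notin> spine n" "id u < id v" for u v
  proof -
    have uv: "u < v" "1 \<le> u" "E u v" using that by (auto simp: adj_G path_edge_def)
    then show ?thesis using that(2) n r s assms spine_iff[OF uv(1)] by (auto simp: path_edge_def)
  qed
qed (use n r assms in auto)

end

section \<open>Edges that cannot be subdivided\<close>

text \<open>The instance of \<open>not_subdividableI\<close> with a single edge between the hubs.
  One \<open>sorted_wrt\<close> premise bundles all disjointness conditions, which for intervals are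
  mere arithmetic.\<close>

lemma not_subdividable_one_edge:
  assumes "{a, b} \<in> F" "a \<in> A" "b \<in> B"
    and "connected_in G A" "connected_in G B"
    and "connected_in G C1" "touches G C1 A" "touches G C1 B"
    and "connected_in G C2" "touches G C2 A" "touches G C2 B"
    and "connected_in G C3" "touches G C3 A" "touches G C3 B"
    and "sorted_wrt (\<lambda>X Y. X \<inter> Y = {}) [A, B, C1, C2, C3]"
  shows "\<not> subdividable G F"
proof (rule not_subdividableI[of G A B "[{a, b}]" "[C1, C2, C3]"])
  show "\<forall>C\<in>set [C1, C2, C3]. connected_in G C \<and> C \<inter> A = {} \<and> C \<inter> B = {} \<and>
      touches G C A \<and> touches G C B"
    using assms(6-) by (simp add: Int_commute)
  show "\<forall>e\<in>set [{a, b}]. \<exists>a\<in>A. \<exists>b\<in>B. e = {a, b}"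
    using assms(2,3) by (simp only: set_simps ball_simps) blast
qed (use assms in simp_all)

lemma not_subdividable_two_edges:
  assumes "{a, b} \<in> F" "a \<in> A" "b \<in> B" and "{a', b'} \<in> F" "a' \<in> A" "b' \<in> B"
    and "{a, b} \<noteq> {a', b'}"
    and "connected_in G A" "connected_in G B"
    and "connected_in G C1" "touches G C1 A" "touches G C1 B"
    and "connected_in G C2" "touches G C2 A" "touches G C2 B"
    and "sorted_wrt (\<lambda>X Y. X \<inter> Y = {}) [A, B, C1, C2]"
  shows "\<not> subdividable G F"
proof (rule not_subdividableI[of G A B "[{a, b}, {a', b'}]" "[C1, C2]"])
  show "\<forall>C\<in>set [C1, C2]. connected_in G C \<and> C \<inter> A = {} \<and> C \<inter> B = {} \<and>
      touches G C A \<and> touches G C B"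
    using assms(8-) by (simp add: Int_commute)
  show "\<forall>e\<in>set [{a, b}, {a', b'}]. \<exists>a\<in>A. \<exists>b\<in>B. e = {a, b}"
    using assms(2,3,5,6) by (simp only: set_simps ball_simps) blast
qed (use assms in simp_all)

context spine_graph
begin

lemma adj_Suc: "v = Suc u \<Longrightarrow> 1 \<le> u \<Longrightarrow> v \<le> n \<Longrightarrow> adj G u v"
  and adj_Suc': "v = Suc u \<Longrightarrow> 1 \<le> u \<Longrightarrow> v \<le> n \<Longrightarrow> adj G v u"
  and adj_1: "n - r \<le> v \<Longrightarrow> v < n \<Longrightarrow> adj G 1 v"
  and adj_1': "n - r \<le> v \<Longrightarrow> v < n \<Longrightarrow> adj G v 1"
  and adj_n: "2 \<le> v \<Longrightarrow> v \<le> Suc s \<Longrightarrow> adj G n v"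
  and adj_n': "2 \<le> v \<Longrightarrow> v \<le> Suc s \<Longrightarrow> adj G v n"
  and adj_1_n: "p \<Longrightarrow> adj G 1 n"
  using n r s by (auto simp: adj_G path_edge_def)

text \<open>Here v_n is a branch set. It meets the first hub in v_2 and the second in v_(s+1), which
  is why that hub extends down to \<open>Suc s\<close>; this is at most \<open>j\<close> by the
  bound on \<open>r + s\<close>.\<close>

lemma not_subdividable_1_inner:
  assumes "{1, j} \<in> F" "n - r \<le> j" "j \<le> n - 2" "1 \<le> r" "3 \<le> s" "r + s \<le> n - 1"
  shows "\<not> subdividable G F"
proof (rule not_subdividable_one_edge[OF assms(1), of "{1..2}" "{Suc s..j}"])
  show "connected_in G {1..2}"
    by (rule connected_in_segment) (use assms n s r in auto)
  show "connected_in G {Suc s..j}"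
    by (rule connected_in_segment) (use assms n s r in auto)
  show "connected_in G {Suc j..n - 1}"
    by (rule connected_in_segment) (use assms n s r in auto)
  show "connected_in G {n}"
    by (rule connected_in_singleton) (use n in auto)
  show "connected_in G {3..s}"
    by (rule connected_in_segment) (use assms n s r in auto)
  show "touches G {Suc j..n - 1} {1..2}"
    by (rule touchesI[of "n - 1" _ "1", OF _ _ adj_1']) (use assms n s r in auto)
  show "touches G {Suc j..n - 1} {Suc s..j}"
    by (rule touchesI[of "Suc j" _ "j", OF _ _ adj_Suc']) (use assms n s r in auto)
  show "touches G {n} {1..2}"
    by (rule touchesI[of "n" _ "2", OF _ _ adj_n]) (use assms n s r in auto)
  show "touches G {n} {Suc s..j}"
    by (rule touchesI[of "n" _ "Suc s", OF _ _ adj_n]) (use assms n s r in auto)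
  show "touches G {3..s} {1..2}"
    by (rule touchesI[of "3" _ "2", OF _ _ adj_Suc']) (use assms n s r in auto)
  show "touches G {3..s} {Suc s..j}"
    by (rule touchesI[of "s" _ "Suc s", OF _ _ adj_Suc]) (use assms n s r in auto)
  show "sorted_wrt (\<lambda>X Y. X \<inter> Y = {}) [{1..2}, {Suc s..j}, {Suc j..n - 1}, {n}, {3..s}]"
    using assms n s r by auto
qed (use assms n s r in \<open>auto simp: doubleton_eq_iff\<close>)

text \<open>The chord v_1 v_(n-3), present for \<open>3 \<le> r\<close>, ties the segment
  \<open>{3..n - 3}\<close> to v_1. For r = 2 the edge v_1 v_(n-1) lies on the second path.\<close>

lemma not_subdividable_1_last:
  assumes "{1, n - 1} \<in> F" "3 \<le> r" "2 \<le> s"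
  shows "\<not> subdividable G F"
proof (rule not_subdividable_one_edge[OF assms(1), of "{1}" "{n - 1..n}"])
  show "connected_in G {1}"
    by (rule connected_in_singleton) (use n in auto)
  show "connected_in G {n - 1..n}"
    by (rule connected_in_segment) (use assms n s r in auto)
  show "connected_in G {2}"
    by (rule connected_in_singleton) (use n in auto)
  show "connected_in G {n - 2}"
    by (rule connected_in_singleton) (use n in auto)
  show "connected_in G {3..n - 3}"
    by (rule connected_in_segment) (use assms n s r in auto)
  show "touches G {2} {1}"
    by (rule touchesI[of "2" _ "1", OF _ _ adj_Suc']) (use assms n s r in auto)
  show "touches G {2} {n - 1..n}"
    by (rule touchesI[of "2" _ "n", OF _ _ adj_n']) (use assms n s r in auto)
  show "touches G {n - 2} {1}"
    by (rule touchesI[of "n - 2" _ "1", OF _ _ adj_1']) (use assms n s r in auto)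
  show "touches G {n - 2} {n - 1..n}"
    by (rule touchesI[of "n - 2" _ "n - 1", OF _ _ adj_Suc]) (use assms n s r in auto)
  show "touches G {3..n - 3} {1}"
    by (rule touchesI[of "n - 3" _ "1", OF _ _ adj_1']) (use assms n s r in auto)
  show "touches G {3..n - 3} {n - 1..n}"
    by (rule touchesI[of "3" _ "n", OF _ _ adj_n']) (use assms n s r in auto)
  show "sorted_wrt (\<lambda>X Y. X \<inter> Y = {}) [{1}, {n - 1..n}, {2}, {n - 2}, {3..n - 3}]"
    using assms n s r by auto
qed (use assms n s r in \<open>auto simp: doubleton_eq_iff\<close>)

text \<open>Here v_1 is a branch set, through its chords to v_(n-r) and v_(n-1);
  \<open>3 \<le> r\<close> leaves a further one strictly between these two vertices.\<close>

lemma not_subdividable_n_middle: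
  assumes "{j, n} \<in> F" "3 \<le> j" "j \<le> Suc s" "3 \<le> r" "r + s \<le> n - 1"
  shows "\<not> subdividable G F"
proof (rule not_subdividable_one_edge[OF assms(1), of "{j..n - r}" "{n - 1..n}"])
  show "connected_in G {j..n - r}"
    by (rule connected_in_segment) (use assms n s r in auto)
  show "connected_in G {n - 1..n}"
    by (rule connected_in_segment) (use assms n s r in auto)
  show "connected_in G {2..j - 1}"
    by (rule connected_in_segment) (use assms n s r in auto)
  show "connected_in G {1}"
    by (rule connected_in_singleton) (use n in auto)
  show "connected_in G {n - r + 1..n - 2}"
    by (rule connected_in_segment) (use assms n s r in auto)
  show "touches G {2..j - 1} {j..n - r}"
    by (rule touchesI[of "j - 1" _ "j", OF _ _ adj_Suc]) (use assms n s r in auto)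
  show "touches G {2..j - 1} {n - 1..n}"
    by (rule touchesI[of "2" _ "n", OF _ _ adj_n']) (use assms n s r in auto)
  show "touches G {1} {j..n - r}"
    by (rule touchesI[of "1" _ "n - r", OF _ _ adj_1]) (use assms n s r in auto)
  show "touches G {1} {n - 1..n}"
    by (rule touchesI[of "1" _ "n - 1", OF _ _ adj_1]) (use assms n s r in auto)
  show "touches G {n - r + 1..n - 2} {j..n - r}"
    by (rule touchesI[of "n - r + 1" _ "n - r", OF _ _ adj_Suc']) (use assms n s r in auto)
  show "touches G {n - r + 1..n - 2} {n - 1..n}"
    by (rule touchesI[of "n - 2" _ "n - 1", OF _ _ adj_Suc]) (use assms n s r in auto)
  show "sorted_wrt (\<lambda>X Y. X \<inter> Y = {}) [{j..n - r}, {n - 1..n}, {2..j - 1}, {1}, {n - r + 1..n - 2}]"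
    using assms n s r by auto
qed (use assms n s r in \<open>auto simp: doubleton_eq_iff\<close>)

text \<open>Both v_3 and v_4 are neighbours of v_n since \<open>3 \<le> s\<close>, and the segment
  starting at v_4 returns to the hub \<open>{1..2}\<close> by the chord v_1 v_(n-2).\<close>

lemma not_subdividable_n_2:
  assumes "{2, n} \<in> F" "2 \<le> r" "3 \<le> s"
  shows "\<not> subdividable G F"
proof (rule not_subdividable_one_edge[OF assms(1), of "{1..2}" "{n}"])
  show "connected_in G {1..2}"
    by (rule connected_in_segment) (use assms n s r in auto)
  show "connected_in G {n}"
    by (rule connected_in_singleton) (use n in auto)
  show "connected_in G {n - 1}"
    by (rule connected_in_singleton) (use n in auto)
  show "connected_in G {3}"
    by (rule connected_in_singleton) (use n in auto)
  show "connected_in G {4..n - 2}"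
    by (rule connected_in_segment) (use assms n s r in auto)
  show "touches G {n - 1} {1..2}"
    by (rule touchesI[of "n - 1" _ "1", OF _ _ adj_1']) (use assms n s r in auto)
  show "touches G {n - 1} {n}"
    by (rule touchesI[of "n - 1" _ "n", OF _ _ adj_Suc]) (use assms n s r in auto)
  show "touches G {3} {1..2}"
    by (rule touchesI[of "3" _ "2", OF _ _ adj_Suc']) (use assms n s r in auto)
  show "touches G {3} {n}"
    by (rule touchesI[of "3" _ "n", OF _ _ adj_n']) (use assms n s r in auto)
  show "touches G {4..n - 2} {1..2}"
    by (rule touchesI[of "n - 2" _ "1", OF _ _ adj_1']) (use assms n s r in auto)
  show "touches G {4..n - 2} {n}"
    by (rule touchesI[of "4" _ "n", OF _ _ adj_n']) (use assms n s r in auto)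
  show "sorted_wrt (\<lambda>X Y. X \<inter> Y = {}) [{1..2}, {n}, {n - 1}, {3}, {4..n - 2}]"
    using assms n s r by auto
qed (use assms n s r in \<open>auto simp: doubleton_eq_iff\<close>)

text \<open>v_2, v_(n-1) and the segment between them give three branch sets for the hubs v_1 and
  v_n; the vertex on v_1 v_n is the fourth.\<close>

lemma not_subdividable_1_n:
  assumes "{1, n} \<in> F" "2 \<le> r" "2 \<le> s"
  shows "\<not> subdividable G F"
proof (rule not_subdividable_one_edge[OF assms(1), of "{1}" "{n}"])
  show "connected_in G {1}"
    by (rule connected_in_singleton) (use n in auto)
  show "connected_in G {n}"
    by (rule connected_in_singleton) (use n in auto)
  show "connected_in G {2}"
    by (rule connected_in_singleton) (use n in auto)
  show "connected_in G {n - 1}"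
    by (rule connected_in_singleton) (use n in auto)
  show "connected_in G {3..n - 2}"
    by (rule connected_in_segment) (use assms n s r in auto)
  show "touches G {2} {1}"
    by (rule touchesI[of "2" _ "1", OF _ _ adj_Suc']) (use assms n s r in auto)
  show "touches G {2} {n}"
    by (rule touchesI[of "2" _ "n", OF _ _ adj_n']) (use assms n s r in auto)
  show "touches G {n - 1} {1}"
    by (rule touchesI[of "n - 1" _ "1", OF _ _ adj_1']) (use assms n s r in auto)
  show "touches G {n - 1} {n}"
    by (rule touchesI[of "n - 1" _ "n", OF _ _ adj_Suc]) (use assms n s r in auto)
  show "touches G {3..n - 2} {1}"
    by (rule touchesI[of "n - 2" _ "1", OF _ _ adj_1']) (use assms n s r in auto)
  show "touches G {3..n - 2} {n}"
    by (rule touchesI[of "3" _ "n", OF _ _ adj_n']) (use assms n s r in auto)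
  show "sorted_wrt (\<lambda>X Y. X \<inter> Y = {}) [{1}, {n}, {2}, {n - 1}, {3..n - 2}]"
    using assms n s r by auto
qed (use assms n s r in \<open>auto simp: doubleton_eq_iff\<close>)

text \<open>The edge v_1 v_n makes v_1 a branch set, so the whole segment \<open>{3..n - 2}\<close>
  can be a hub.\<close>

lemma not_subdividable_n_middle_plus:
  assumes "{j, n} \<in> F" "3 \<le> j" "j \<le> n - 2" "2 \<le> r" "1 \<le> s" "p"
  shows "\<not> subdividable G F"
proof (rule not_subdividable_one_edge[OF assms(1), of "{3..n - 2}" "{n}"])
  show "connected_in G {3..n - 2}"
    by (rule connected_in_segment) (use assms n s r in auto)
  show "connected_in G {n}"
    by (rule connected_in_singleton) (use n in auto)
  show "connected_in G {2}"
    by (rule connected_in_singleton) (use n in auto)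
  show "connected_in G {n - 1}"
    by (rule connected_in_singleton) (use n in auto)
  show "connected_in G {1}"
    by (rule connected_in_singleton) (use n in auto)
  show "touches G {2} {3..n - 2}"
    by (rule touchesI[of "2" _ "3", OF _ _ adj_Suc]) (use assms n s r in auto)
  show "touches G {2} {n}"
    by (rule touchesI[of "2" _ "n", OF _ _ adj_n']) (use assms n s r in auto)
  show "touches G {n - 1} {3..n - 2}"
    by (rule touchesI[of "n - 1" _ "n - 2", OF _ _ adj_Suc']) (use assms n s r in auto)
  show "touches G {n - 1} {n}"
    by (rule touchesI[of "n - 1" _ "n", OF _ _ adj_Suc]) (use assms n s r in auto)
  show "touches G {1} {3..n - 2}"
    by (rule touchesI[of "1" _ "n - 2", OF _ _ adj_1]) (use assms n s r in auto)
  show "touches G {1} {n}"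
    by (rule touchesI[of "1" _ "n", OF _ _ adj_1_n]) (use assms n s r in auto)
  show "sorted_wrt (\<lambda>X Y. X \<inter> Y = {}) [{3..n - 2}, {n}, {2}, {n - 1}, {1}]"
    using assms n s r by auto
qed (use assms n s r in \<open>auto simp: doubleton_eq_iff\<close>)

text \<open>Works in both families: v_1 joins the hub of v_j through the chord v_1 v_(n-2), and
  \<open>4 \<le> j\<close> leaves v_3, ..., v_(j-1) as a branch set.\<close>

lemma not_subdividable_n_ge_4:
  assumes "{j, n} \<in> F" "4 \<le> j" "j \<le> n - 2" "2 \<le> r" "2 \<le> s"
  shows "\<not> subdividable G F"
proof (rule not_subdividable_one_edge[OF assms(1), of "(insert 1 {j..n - 2})" "{n}"])
  show "connected_in G (insert 1 {j..n - 2})"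
  proof (rule connected_in_insert[of G _ _ "n - 2"])
    show "connected_in G {j..n - 2}"
      by (rule connected_in_segment) (use assms in auto)
    show "adj G (n - 2) 1" by (rule adj_1') (use assms n in auto)
  qed (use assms n in auto)
  show "connected_in G {n}"
    by (rule connected_in_singleton) (use n in auto)
  show "connected_in G {n - 1}"
    by (rule connected_in_singleton) (use n in auto)
  show "connected_in G {2}"
    by (rule connected_in_singleton) (use n in auto)
  show "connected_in G {3..j - 1}"
    by (rule connected_in_segment) (use assms n s r in auto)
  show "touches G {n - 1} (insert 1 {j..n - 2})"
    by (rule touchesI[of "n - 1" _ "1", OF _ _ adj_1']) (use assms n s r in auto)
  show "touches G {n - 1} {n}"
    by (rule touchesI[of "n - 1" _ "n", OF _ _ adj_Suc]) (use assms n s r in auto)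
  show "touches G {2} (insert 1 {j..n - 2})"
    by (rule touchesI[of "2" _ "1", OF _ _ adj_Suc']) (use assms n s r in auto)
  show "touches G {2} {n}"
    by (rule touchesI[of "2" _ "n", OF _ _ adj_n']) (use assms n s r in auto)
  show "touches G {3..j - 1} (insert 1 {j..n - 2})"
    by (rule touchesI[of "j - 1" _ "j", OF _ _ adj_Suc]) (use assms n s r in auto)
  show "touches G {3..j - 1} {n}"
    by (rule touchesI[of "3" _ "n", OF _ _ adj_n']) (use assms n s r in auto)
  show "sorted_wrt (\<lambda>X Y. X \<inter> Y = {}) [(insert 1 {j..n - 2}), {n}, {n - 1}, {2}, {3..j - 1}]"
    using assms n s r by auto
qed (use assms n s r in \<open>auto simp: doubleton_eq_iff\<close>)

text \<open>With v_3 in a hub, two further chords of v_n are used, to v_4 and v_5; hence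
  \<open>4 \<le> s\<close>.\<close>

lemma not_subdividable_n_3:
  assumes "{3, n} \<in> F" "2 \<le> r" "4 \<le> s"
  shows "\<not> subdividable G F"
proof (rule not_subdividable_one_edge[OF assms(1), of "{1..3}" "{n}"])
  show "connected_in G {1..3}"
    by (rule connected_in_segment) (use assms n s r in auto)
  show "connected_in G {n}"
    by (rule connected_in_singleton) (use n in auto)
  show "connected_in G {n - 1}"
    by (rule connected_in_singleton) (use n in auto)
  show "connected_in G {4}"
    by (rule connected_in_singleton) (use n in auto)
  show "connected_in G {5..n - 2}"
    by (rule connected_in_segment) (use assms n s r in auto)
  show "touches G {n - 1} {1..3}"
    by (rule touchesI[of "n - 1" _ "1", OF _ _ adj_1']) (use assms n s r in auto)
  show "touches G {n - 1} {n}"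
    by (rule touchesI[of "n - 1" _ "n", OF _ _ adj_Suc]) (use assms n s r in auto)
  show "touches G {4} {1..3}"
    by (rule touchesI[of "4" _ "3", OF _ _ adj_Suc']) (use assms n s r in auto)
  show "touches G {4} {n}"
    by (rule touchesI[of "4" _ "n", OF _ _ adj_n']) (use assms n s r in auto)
  show "touches G {5..n - 2} {1..3}"
    by (rule touchesI[of "n - 2" _ "1", OF _ _ adj_1']) (use assms n s r in auto)
  show "touches G {5..n - 2} {n}"
    by (rule touchesI[of "5" _ "n", OF _ _ adj_n']) (use assms n s r in auto)
  show "sorted_wrt (\<lambda>X Y. X \<inter> Y = {}) [{1..3}, {n}, {n - 1}, {4}, {5..n - 2}]"
    using assms n s r by auto
qed (use assms n s r in \<open>auto simp: doubleton_eq_iff\<close>)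

text \<open>Joining v_1 to v_(n-2) in one hub makes both edges run between the hubs, so two branch
  sets are enough.\<close>

lemma not_subdividable_two_at_last:
  assumes "{1, n - 1} \<in> F" "{n - 2, n - 1} \<in> F" "2 \<le> r" "2 \<le> s"
  shows "\<not> subdividable G F"
proof (rule not_subdividable_two_edges[OF assms(1) _ _ assms(2), of "{1, n - 2}" "{n - 1..n}"])
  show "connected_in G {1, n - 2}"
    by (rule connected_in_edge[OF _ _ adj_1]) (use assms n in auto)
  show "connected_in G {n - 1..n}"
    by (rule connected_in_segment) (use assms n s r in auto)
  show "connected_in G {2}"
    by (rule connected_in_singleton) (use n in auto)
  show "connected_in G {3..n - 3}"
    by (rule connected_in_segment) (use assms n s r in auto)
  show "touches G {2} {1, n - 2}"
    by (rule touchesI[of "2" _ "1", OF _ _ adj_Suc']) (use assms n s r in auto)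
  show "touches G {2} {n - 1..n}"
    by (rule touchesI[of "2" _ "n", OF _ _ adj_n']) (use assms n s r in auto)
  show "touches G {3..n - 3} {1, n - 2}"
    by (rule touchesI[of "n - 3" _ "n - 2", OF _ _ adj_Suc]) (use assms n s r in auto)
  show "touches G {3..n - 3} {n - 1..n}"
    by (rule touchesI[of "3" _ "n", OF _ _ adj_n']) (use assms n s r in auto)
  show "sorted_wrt (\<lambda>X Y. X \<inter> Y = {}) [{1, n - 2}, {n - 1..n}, {2}, {3..n - 3}]"
    using assms n s r by auto
qed (use assms n s r in \<open>auto simp: doubleton_eq_iff\<close>)

end

section \<open>The second path for r = 2\<close>

definition second_path :: "nat \<Rightarrow> nat set set" where
  "second_path n = walk_edges (rev [1..<n-1] @ [n-1, n])"

text \<open>In this form it is visibly the spine with v_(n-2) v_(n-1) exchanged for v_1 v_(n-1), the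
  pair that \<open>not_subdividable_two_at_last\<close> forbids together.\<close>

lemma second_path_eq:
  assumes "3 \<le> n"
  shows "second_path n =
    insert {n-1, n} (insert {1, n-1} {{i, Suc i} | i. 1 \<le> i \<and> Suc i < n - 1})"
proof -
  let ?xs = "rev [1..<n-1]"
  have ne: "[1..<n-1] \<noteq> []" "?xs \<noteq> []" using assms by simp_all
  have "second_path n = walk_edges ((?xs @ [n-1]) @ [n])" by (simp add: second_path_def)
  also have "\<dots> = insert {n-1, n} (walk_edges (?xs @ [n-1]))"
    by (subst walk_edges_snoc) simp_all
  also have "walk_edges (?xs @ [n-1]) = insert {1, n-1} (walk_edges [1..<n-1])"
  proof -
    have "last ?xs = 1" unfolding last_rev using assms by (subst hd_upt) simp_all
    then show ?thesis unfolding walk_edges_snoc[OF ne(2)] walk_edges_rev by simp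
  qed
  also have "walk_edges [1..<n-1] = {{i, Suc i} | i. 1 \<le> i \<and> Suc i < n - 1}"
    by (rule walk_edges_upt)
  finally show ?thesis .
qed

context spine_graph
begin

text \<open>After the reversal v_(n-2) has position 1 and v_1 has position \<open>n - 2 = k\<close>.
  The edges from v_(n-2) to v_1 and v_(n-1) thus belong to the fan of the first end, and the chords
  of v_n go to positions up to \<open>k\<close>.\<close>

lemma subdividable_second_path:
  assumes "r = 2" "2 \<le> s"
  shows "subdividable G (second_path n)"
proof (rule subdividable_double_fanI[of 1 "n - 2" n "\<lambda>v. if v \<le> n - 2 then n - 1 - v else v"])
  let ?pos = "\<lambda>v. if v \<le> n - 2 then n - 1 - v else v"
  have n3: "3 \<le> n" using n by simp
  note path_eq = second_path_eq[OF n3]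
  have cases: "e = {n-1, n} \<or> e = {1, n-1} \<or> (\<exists>i. e = {i, Suc i} \<and> 1 \<le> i \<and> Suc i < n - 1)"
    if "e \<in> second_path n" for e
    using that unfolding path_eq by blast
  show "second_path n \<subseteq> edges G"
  proof
    fix e assume "e \<in> second_path n"
    from cases[OF this] show "e \<in> edges G"
    proof (elim disjE exE conjE)
      assume "e = {n-1, n}"
      moreover have "adj G (n-1) n" by (rule adj_Suc) (use n in auto)
      ultimately show ?thesis by (simp add: adj_def)
    next
      assume "e = {1, n-1}"
      moreover have "adj G 1 (n-1)" by (rule adj_1) (use n assms in auto)
      ultimately show ?thesis by (simp add: adj_def)
    next
      fix i assume "e = {i, Suc i}" "1 \<le> i" "Suc i < n - 1"
      moreover from this have "adj G i (Suc i)" by (intro adj_Suc) auto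
      ultimately show ?thesis by (simp add: adj_def)
    qed
  qed
  show "\<exists>u\<in>verts G. \<exists>v\<in>verts G. e = {u, v} \<and> ?pos v = Suc (?pos u)"
    if "e \<in> second_path n" for e
    using cases[OF that]
  proof (elim disjE exE conjE)
    assume "e = {n-1, n}"
    then show ?thesis using n by (intro bexI[of _ "n-1"] bexI[of _ n]) auto
  next
    assume "e = {1, n-1}"
    then show ?thesis using n by (intro bexI[of _ 1] bexI[of _ "n-1"]) auto
  next
    fix i assume "e = {i, Suc i}" "1 \<le> i" "Suc i < n - 1"
    then show ?thesis using n by (intro bexI[of _ "Suc i"] bexI[of _ i]) auto
  qed
  show "\<not> adj G v v" for v by (simp add: adj_G path_edge_def)
  \<comment> \<open>\<open>E\<close> orders the ends by index, which the reversal may turn around: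
    v_1 v_(n-2) falls under the third alternative, which \<open>?pos u < ?pos v\<close> later
    excludes.\<close>
  have key: "?pos a = 1 \<and> n - 2 \<le> ?pos b \<or> ?pos b = n \<and> ?pos a \<le> n - 2 \<or> ?pos b = 1 \<and> n - 2 \<le> ?pos a"
    if ab: "E a b" "{a, b} \<notin> second_path n" for a b
  proof -
    have bd: "1 \<le> a" "a < b" "b \<le> n" using ab by (auto simp: path_edge_def)
    from ab(1) consider "b = Suc a" | "a = 1" "n - 2 \<le> b" "b < n" | "b = n" "2 \<le> a" "a \<le> Suc s"
      | "a = 1" "b = n"
      unfolding path_edge_def assms(1) by blast
    then show ?thesis
    proof cases
      case 1
      have "a \<noteq> n - 1"
      proof
        assume "a = n - 1"
        then have "{a, b} = {n-1, n}" using 1 n by simp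
        with ab(2) show False unfolding path_eq by blast
      qed
      moreover have "\<not> Suc a < n - 1"
      proof
        assume "Suc a < n - 1"
        with 1 bd have "{a, b} \<in> {{i, Suc i} | i. 1 \<le> i \<and> Suc i < n - 1}" by blast
        with ab(2) show False unfolding path_eq by blast
      qed
      ultimately have "a = n - 2" "b = n - 1" using 1 bd by linarith+
      then show ?thesis using n by simp
    next
      case 2
      have "b \<noteq> n - 1"
      proof
        assume "b = n - 1"
        with 2 have "{a, b} = {1, n-1}" by simp
        with ab(2) show False unfolding path_eq by blast
      qed
      then have "b = n - 2" using 2 by linarith
      then have "?pos b = 1" "?pos a = n - 2" using 2 n by auto
      then show ?thesis by simp
    next
      case 3
      then have "?pos b = n" "?pos a \<le> n - 2" using n s by auto
      then show ?thesis by simp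
    next
      case 4
      then have "?pos b = n" "?pos a \<le> n - 2" using n by auto
      then show ?thesis by simp
    qed
  qed
  show "?pos u = 1 \<and> n - 2 \<le> ?pos v \<or> ?pos v = n \<and> ?pos u \<le> n - 2"
    if "adj G u v" "{u, v} \<notin> second_path n" "?pos u < ?pos v" for u v
  proof -
    have "?pos u \<noteq> n \<or> \<not> ?pos v \<le> n - 2" "\<not> (?pos v = 1 \<and> n - 2 \<le> ?pos u)"
      using that(3) n by linarith+
    moreover have "E u v \<or> E v u" using that(1) by (simp add: adj_G)
    moreover have "{v, u} \<notin> second_path n" using that(2) by (simp add: insert_commute)
    ultimately show ?thesis using key[of u v] key[of v u] that(2) by metis
  qed
  show "inj_on ?pos (verts G)"
  proof (rule inj_onI)
    fix u v assume "u \<in> verts G" "v \<in> verts G" and eq: "?pos u = ?pos v"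
    then have "1 \<le> u" "1 \<le> v" by simp_all
    then show "u = v" using eq n by (simp split: if_splits; linarith)
  qed
  show "?pos ` verts G \<subseteq> {1..n}" using n by auto
qed (use n in auto)

section \<open>Upper bounds and the maximal sets for r \<ge> 2\<close>

lemma subdividable_imp_spine:
  assumes F: "subdividable G F" and "3 \<le> r" "r \<le> s" "r + s \<le> n - 1"
  shows "F \<subseteq> spine n"
proof
  fix e assume e: "e \<in> F"
  then have "e \<in> edges G" using F by (auto simp: subdividable_def)
  then obtain u v where uv: "e = {u, v}" "E u v" unfolding edges_G by blast
  then have bd: "1 \<le> u" "u < v" "v \<le> n" by (auto simp: path_edge_def)
  show "e \<in> spine n"
  proof (rule ccontr)
    assume "e \<notin> spine n"
    then have "v \<noteq> Suc u" using bd uv(1) spine_iff[OF bd(2)] by auto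
    with uv(2) consider "u = 1" "n - r \<le> v" "v < n" | "v = n" "2 \<le> u" "u \<le> Suc s"
      | "u = 1" "v = n"
      unfolding path_edge_def by blast
    then show False
    proof cases
      case 1
      then consider "v = n - 1" | "v \<le> n - 2" by linarith
      then show False
        using 1 e uv(1) F assms not_subdividable_1_last[of F] not_subdividable_1_inner[of v F]
        by cases auto
    next
      case 2
      then consider "u = 2" | "3 \<le> u" by linarith
      then show False
        using 2 e uv(1) F assms not_subdividable_n_2[of F] not_subdividable_n_middle[of u F]
        by cases auto
    next
      case 3
      then show False using e uv(1) F assms not_subdividable_1_n[of F] by auto
    qed
  qed
qed

text \<open>The obstructions to single edges leave the spine and v_1 v_(n-1). If the latter is in
  \<open>F\<close>, the forbidden pair removes v_(n-2) v_(n-1), and the rest of the spine belongs to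
  the second path.\<close>

lemma subdividable_imp_spine_or_second_path:
  assumes F: "subdividable G F" and "r = 2" "3 \<le> s" "p \<or> 4 \<le> s"
  shows "F \<subseteq> spine n \<or> F \<subseteq> second_path n"
proof -
  have spine: "e \<in> spine n \<or> e = {1, n - 1}" if e: "e \<in> F" for e
  proof (rule ccontr)
    assume no: "\<not> ?thesis"
    have "e \<in> edges G" using F e by (auto simp: subdividable_def)
    then obtain u v where uv: "e = {u, v}" "E u v" unfolding edges_G by blast
    then have bd: "1 \<le> u" "u < v" "v \<le> n" by (auto simp: path_edge_def)
    have "v \<noteq> Suc u" using no bd uv(1) spine_iff[OF bd(2)] by auto
    with uv(2) consider "u = 1" "n - r \<le> v" "v < n" | "v = n" "2 \<le> u" "u \<le> Suc s"
      | "u = 1" "v = n"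
      unfolding path_edge_def by blast
    then show False
    proof cases
      case 1
      with no uv(1) have "v \<noteq> n - 1" by auto
      with 1 have "v \<le> n - 2" by linarith
      moreover have "r + s \<le> n - 1" using assms s n by linarith
      ultimately show False
        using 1 e uv(1) F assms not_subdividable_1_inner[of v F] by auto
    next
      case 2
      have "u \<le> n - 2" using 2 s n by linarith
      have e: "{u, n} \<in> F" using 2 e uv(1) by simp
      \<comment> \<open>\<open>p \<or> 4 \<le> s\<close> settles the case \<open>u = 3\<close>; the
        other values are covered in both families.\<close>
      consider "u = 2" | "3 \<le> u" "p" | "4 \<le> u" | "u = 3" "4 \<le> s" using 2 assms by linarith
      then have "\<not> subdividable G F"
      proof cases
        case 1
        with e not_subdividable_n_2[of F] assms show ?thesis by simp
      next
        case 2
        with not_subdividable_n_middle_plus[OF e] \<open>u \<le> n - 2\<close> assms show ?thesis by simp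
      next
        case 3
        with not_subdividable_n_ge_4[OF e] \<open>u \<le> n - 2\<close> assms show ?thesis by simp
      next
        case 4
        with e not_subdividable_n_3[of F] assms show ?thesis by simp
      qed
      with F show False by simp
    next
      case 3
      then show False using e uv(1) F assms not_subdividable_1_n[of F] by auto
    qed
  qed
  show ?thesis
  proof (cases "{1, n - 1} \<in> F")
    case False
    then show ?thesis using spine by blast
  next
    case True
    have "e \<in> second_path n" if e: "e \<in> F" for e
    proof (cases "e = {1, n - 1}")
      case True
      then show ?thesis using n second_path_eq[of n] by simp
    next
      case False
      with spine[OF e] obtain i where i: "e = {i, Suc i}" "1 \<le> i" "i < n"
        unfolding spine_eq by blast
      have "i \<noteq> n - 2"
      proof
        assume "i = n - 2"
        moreover have "Suc (n - 2) = n - 1" using n by linarith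
        ultimately have "{n - 2, n - 1} \<in> F" using e i(1) by simp
        from not_subdividable_two_at_last[OF True this] F assms show False by simp
      qed
      with i n consider "i = n - 1" | "Suc i < n - 1" by linarith
      then show ?thesis
      proof cases
        case 1
        then have "e = {n - 1, n}" using i n by simp
        then show ?thesis using n second_path_eq[of n] by simp
      next
        case 2
        with i have "e \<in> {{i, Suc i} | i. 1 \<le> i \<and> Suc i < n - 1}" by blast
        then show ?thesis using n second_path_eq[of n] by simp
      qed
    qed
    then show ?thesis by blast
  qed
qed

lemma spine_second_path_incomparable: "\<not> spine n \<subseteq> second_path n" "\<not> second_path n \<subseteq> spine n"
proof -
  have "{1, n - 1} \<in> second_path n" using n second_path_eq[of n] by simp
  moreover have "{1, n - 1} \<notin> spine n" using n by (subst spine_iff) auto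
  ultimately show "\<not> second_path n \<subseteq> spine n" by blast
  have "{n - 2, n - 1} \<in> spine n" using n by (subst spine_iff) auto
  moreover have "{n - 2, n - 1} \<notin> second_path n"
  proof -
    have "\<not> ({n - 2, n - 1} = {i, Suc i} \<and> Suc i < n - 1)" for i
      unfolding doubleton_eq_iff by linarith
    moreover have "{n - 2, n - 1} \<noteq> {n - 1, n}" "{n - 2, n - 1} \<noteq> {1, n - 1}"
      unfolding doubleton_eq_iff using n by linarith+
    moreover have "3 \<le> n" using n by simp
    ultimately show ?thesis unfolding second_path_eq[OF \<open>3 \<le> n\<close>] by blast
  qed
  ultimately show "\<not> spine n \<subseteq> second_path n" by blast
qed

lemma maximal_subdividable_r_ge_3:
  assumes "3 \<le> r" "r \<le> s" "r + s \<le> n - 1"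
  shows "{F. maximal_subdividable G F} = {spine n}"
proof (rule maximal_subdividable_eqI)
  show "subdividable G S" if "S \<in> {spine n}" for S
    using that subdividable_spine assms by simp
qed (use subdividable_imp_spine assms in auto)

lemma maximal_subdividable_r_2:
  assumes "r = 2" "3 \<le> s" "p \<or> 4 \<le> s"
  shows "{F. maximal_subdividable G F} = {spine n, second_path n}"
proof (rule maximal_subdividable_eqI)
  have "subdividable G (spine n)" using assms n s by (intro subdividable_spine) auto
  moreover have "subdividable G (second_path n)" using assms by (intro subdividable_second_path) auto
  ultimately show "subdividable G S" if "S \<in> {spine n, second_path n}" for S using that by auto
  show "\<exists>S\<in>{spine n, second_path n}. F \<subseteq> S" if "subdividable G F" for F
    using subdividable_imp_spine_or_second_path[OF that assms] by simp
  show "S = T" if "S \<in> {spine n, second_path n}" "T \<in> {spine n, second_path n}" "S \<subseteq> T" for S T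
    using that spine_second_path_incomparable by auto
qed

end

section \<open>The wheel\<close>

lemma spine_graph_wheel: "6 \<le> n \<Longrightarrow> spine_graph True n 1 (n - 3) (wheel n)"
  by unfold_locales (auto simp: wheel_def)

text \<open>The chords join v_n to v_2, ..., v_(n-2), the spine adds v_(n-1) and the extra edge adds
  v_1, so every rim vertex is a neighbour of v_n.\<close>

lemma path_edge_wheel:
  assumes "6 \<le> n"
  shows "path_edge True n 1 (n - 3) u v \<longleftrightarrow>
    1 \<le> u \<and> u < v \<and> v \<le> n \<and> (v = n \<or> v = Suc u \<or> u = 1 \<and> v = n - 1)"
  using assms unfolding path_edge_def by presburger

lemma adj_wheel:
  assumes "6 \<le> n" "1 \<le> u" "u < v" "v \<le> n" "v = n \<or> v = Suc u \<or> u = 1 \<and> v = n - 1"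
  shows "adj (wheel n) u v" "adj (wheel n) v u"
  unfolding spine_graph.adj_G[OF spine_graph_wheel[OF assms(1)]] path_edge_wheel[OF assms(1)]
  using assms by blast+

lemma wheel_rim_eq:
  assumes "2 \<le> n"
  shows "wheel_rim n = insert {1, n - 1} {{i, Suc i} | i. 1 \<le> i \<and> Suc i < n}"
proof -
  have "[1..<n] \<noteq> []" "last [1..<n] = n - 1" using assms by simp_all
  then have "wheel_rim n = insert {n - 1, 1} (walk_edges [1..<n])"
    unfolding wheel_rim_def using walk_edges_snoc[of "[1..<n]" 1] by simp
  then show ?thesis unfolding walk_edges_upt by (simp add: insert_commute)
qed

lemma edges_wheel:
  assumes "6 \<le> n"
  shows "edges (wheel n) = wheel_rim n \<union> (\<lambda>q. {q, n}) ` {1..n - 1}"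
proof -
  have rim: "wheel_rim n = insert {1, n - 1} {{i, Suc i} | i. 1 \<le> i \<and> Suc i < n}"
    using assms by (intro wheel_rim_eq) simp
  have "e \<in> edges (wheel n) \<longleftrightarrow> e \<in> wheel_rim n \<or> (\<exists>q\<in>{1..n - 1}. e = {q, n})" for e
  proof
    assume "e \<in> edges (wheel n)"
    then obtain u v where uv: "e = {u, v}" "1 \<le> u" "u < v" "v \<le> n"
      "v = n \<or> v = Suc u \<or> u = 1 \<and> v = n - 1"
      unfolding spine_graph.edges_G[OF spine_graph_wheel[OF assms]] path_edge_wheel[OF assms] by blast
    then consider "v = n" | "v = Suc u" "v < n" | "u = 1" "v = n - 1" by linarith
    then show "e \<in> wheel_rim n \<or> (\<exists>q\<in>{1..n - 1}. e = {q, n})"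
    proof cases
      case 1
      with uv have "u \<in> {1..n - 1}" "e = {u, n}" by auto
      then show ?thesis by blast
    next
      case 2
      with uv have "e \<in> {{i, Suc i} | i. 1 \<le> i \<and> Suc i < n}" by blast
      then show ?thesis unfolding rim by simp
    next
      case 3
      with uv show ?thesis unfolding rim by simp
    qed
  next
    assume "e \<in> wheel_rim n \<or> (\<exists>q\<in>{1..n - 1}. e = {q, n})"
    then have "e = {1, n - 1} \<or> (\<exists>i. e = {i, Suc i} \<and> 1 \<le> i \<and> Suc i < n) \<or>
        (\<exists>q\<in>{1..n - 1}. e = {q, n})"
      unfolding rim by blast
    then show "e \<in> edges (wheel n)"
    proof (elim disjE exE bexE conjE)
      assume "e = {1, n - 1}"
      moreover have "adj (wheel n) 1 (n - 1)" by (rule adj_wheel) (use assms in auto)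
      ultimately show ?thesis by (simp add: adj_def)
    next
      fix i assume "e = {i, Suc i}" "1 \<le> i" "Suc i < n"
      moreover from this have "adj (wheel n) i (Suc i)" using assms by (intro adj_wheel) auto
      ultimately show ?thesis by (simp add: adj_def)
    next
      fix q assume "e = {q, n}" "q \<in> {1..n - 1}"
      moreover from this have "adj (wheel n) q n" using assms by (intro adj_wheel) auto
      ultimately show ?thesis by (simp add: adj_def)
    qed
  qed
  then show ?thesis by blast
qed

text \<open>One hub is v_n, the other a rim arc joining the two spokes; two rim vertices next to the
  arc are the branch sets, their own spokes leading to v_n. The arc has to leave two rim vertices
  free: the outer arc does so if \<open>x\<close> and \<open>y\<close> are at least 3 apart, and
  otherwise the inner arc has at most three of the at least five rim vertices.\<close>

lemma not_subdividable_spokes: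
  assumes n: "6 \<le> n" and F: "{x, n} \<in> F" "{y, n} \<in> F" and xy: "1 \<le> x" "x < y" "y < n"
  shows "\<not> subdividable (wheel n) F"
proof -
  interpret spine_graph True n 1 "n - 3" "wheel n" using n by (rule spine_graph_wheel)
  have *: ?thesis
    if A: "connected_in (wheel n) A" "x \<in> A" "y \<in> A" "n \<notin> A"
      and cd: "1 \<le> c" "c < n" "1 \<le> d" "d < n" "c \<noteq> d" "c \<notin> A" "d \<notin> A"
        "touches (wheel n) {c} A" "touches (wheel n) {d} A" for A c d
  proof (rule not_subdividable_two_edges[OF F(1) _ _ F(2), of A "{n}" _ "{c}" "{d}"])
    show "{x, n} \<noteq> {y, n}" using xy by (auto simp: doubleton_eq_iff)
    have "adj (wheel n) c n" "adj (wheel n) d n" by (rule adj_wheel(1); use n cd in simp)+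
    then show "touches (wheel n) {c} {n}" "touches (wheel n) {d} {n}"
      by (simp_all add: touches_def)
    show "connected_in (wheel n) {c}" "connected_in (wheel n) {d}" "connected_in (wheel n) {n}"
      using cd n by (simp_all add: connected_in_singleton)
    show "sorted_wrt (\<lambda>X Y. X \<inter> Y = {}) [A, {n}, {c}, {d}]"
      using A cd by simp
  qed (use A cd in simp_all)
  \<comment> \<open>The last two cases are inner arcs reaching an end of the numbering, where one
    neighbour is found across the rim edge v_1 v_(n-1).\<close>
  consider "3 \<le> y - x" | "y - x < 3" "2 \<le> x" "y \<le> n - 2" | "y - x < 3" "x = 1" | "y - x < 3" "y = n - 1"
    using xy by linarith
  then show ?thesis
  proof cases
    case 1
    show ?thesis
    proof (rule *)
      show "connected_in (wheel n) ({1..x} \<union> {y..n - 1})"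
      proof (rule connected_in_Un[of _ _ _ 1 "n - 1"])
        show "connected_in (wheel n) {1..x}" "connected_in (wheel n) {y..n - 1}"
          using xy by (auto intro!: connected_in_segment)
        show "adj (wheel n) 1 (n - 1)" by (rule adj_wheel) (use n in auto)
      qed (use xy in auto)
      show "touches (wheel n) {x + 1} ({1..x} \<union> {y..n - 1})"
        by (rule touchesI[of "x + 1" _ x, OF _ _ adj_wheel(2)]) (use n xy in auto)
      show "touches (wheel n) {y - 1} ({1..x} \<union> {y..n - 1})"
        by (rule touchesI[of "y - 1" _ y, OF _ _ adj_wheel(1)]) (use n xy in auto)
    qed (use 1 xy in auto)
  next
    case 2
    show ?thesis
    proof (rule *)
      show "connected_in (wheel n) {x..y}" using xy by (auto intro!: connected_in_segment)
      show "touches (wheel n) {x - 1} {x..y}"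
        by (rule touchesI[of "x - 1" _ x, OF _ _ adj_wheel(1)]) (use n xy 2 in auto)
      show "touches (wheel n) {y + 1} {x..y}"
        by (rule touchesI[of "y + 1" _ y, OF _ _ adj_wheel(2)]) (use n xy 2 in auto)
    qed (use n 2 xy in auto)
  next
    case 3
    show ?thesis
    proof (rule *)
      show "connected_in (wheel n) {x..y}" using xy by (auto intro!: connected_in_segment)
      show "touches (wheel n) {n - 1} {x..y}"
        by (rule touchesI[of "n - 1" _ x, OF _ _ adj_wheel(2)]) (use n xy 3 in auto)
      show "touches (wheel n) {y + 1} {x..y}"
        by (rule touchesI[of "y + 1" _ y, OF _ _ adj_wheel(2)]) (use n xy 3 in auto)
    qed (use n 3 xy in auto)
  next
    case 4
    show ?thesis
    proof (rule *)
      show "connected_in (wheel n) {x..y}" using xy by (auto intro!: connected_in_segment)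
      show "touches (wheel n) {x - 1} {x..y}"
        by (rule touchesI[of "x - 1" _ x, OF _ _ adj_wheel(1)]) (use n xy 4 in auto)
      show "touches (wheel n) {1} {x..y}"
        by (rule touchesI[of 1 _ y, OF _ _ adj_wheel(1)]) (use n xy 4 in auto)
    qed (use n 4 xy in auto)
  qed
qed

text \<open>Walking around the rim from the end \<open>q\<close> of the subdivided spoke to the vertex that subdivides
  the last rim edge, then to the one that subdivides the spoke and to the hub, gives the path of a
  double fan: its ends \<open>q\<close> and the hub are adjacent to the last three vertices and to rim vertices,
  respectively.\<close>

lemma subdividable_rim_spoke:
  assumes n: "6 \<le> n" and q: "1 \<le> q" "q < n"
  shows "subdividable (wheel n) (insert {q, n} (wheel_rim n))"
  unfolding subdividable_def
proof
  let ?F = "insert {q, n} (wheel_rim n)"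
  let ?W = "wheel n"
  \<comment> \<open>Rim vertices get the even numbers up to \<open>2 * n - 4\<close>, followed by
    the vertex on the last rim edge, the one on the spoke, and the hub. With
    \<open>k = 2 * n - 3\<close> both of these new vertices are in the fan of \<open>q\<close> at 0.
    As the two subdivided edges do not join consecutive positions,
    \<open>subdividable_double_fanI\<close> does not cover this.\<close>
  let ?D = "double_fan 0 (2 * n - 3) (2 * n - 1)"
  have verts: "verts ?W = {1..n}"
    by (rule spine_graph.verts_G[OF spine_graph_wheel[OF n]])
  have edges: "edges ?W = wheel_rim n \<union> (\<lambda>q. {q, n}) ` {1..n - 1}"
    by (rule edges_wheel[OF n])
  show "?F \<subseteq> edges ?W" unfolding edges using q by auto
  \<comment> \<open>Steps around the rim from \<open>q\<close>, that is \<open>v - q\<close> modulo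
    \<open>n - 1\<close>; \<open>l\<close> is the rim vertex at which the walk ends.\<close>
  define pos where "pos v = (if q \<le> v then v - q else v + (n - 1) - q)" for v
  define l where "l = (if q = 1 then n - 1 else q - 1)"
  define f where "f = case_sum (\<lambda>v. if v = n then 2 * n - 1 else 2 * pos v)
    (\<lambda>e. if e = {q, n} then 2 * n - 2 else if e = {l, q} then 2 * n - 3 else sum pos e)"
  have pos_le: "pos v \<le> n - 2" if "1 \<le> v" "v < n" for v
    using that q by (auto simp: pos_def)
  have l: "1 \<le> l" "l < n" "l \<noteq> q" "pos l = n - 2" using n q by (auto simp: l_def pos_def)
  have pos_q: "pos q = 0" by (simp add: pos_def)
  have inj_pos: "inj_on pos {1..<n}"
    using q by (auto simp: inj_on_def pos_def split: if_splits)
  have f_Inl: "f (Inl v) = 2 * pos v" if "v < n" for v using that by (simp add: f_def)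
  have f_n: "f (Inl n) = 2 * n - 1" by (simp add: f_def)
  have f_spoke: "f (Inr {q, n}) = 2 * n - 2" by (simp add: f_def)
  have f_last: "f (Inr {l, q}) = 2 * n - 3" using l by (simp add: f_def doubleton_eq_iff)
  have f_rim: "f (Inr {u, v}) = Suc (2 * pos u)" if "u < n" "v < n" "pos v = Suc (pos u)" for u v
  proof -
    have "u \<noteq> v" using that by auto
    moreover have "{u, v} \<noteq> {q, n}" using that by (auto simp: doubleton_eq_iff)
    moreover have "{u, v} \<noteq> {l, q}" using that l(4) pos_q n by (auto simp: doubleton_eq_iff)
    ultimately show ?thesis using that by (simp add: f_def)
  qed
  have rim: "e = {l, q} \<or> (\<exists>u v. 1 \<le> u \<and> u < n \<and> 1 \<le> v \<and> v < n \<and> e = {u, v} \<and> pos v = Suc (pos u))"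
    if "e \<in> wheel_rim n" for e
  proof -
    have n2: "2 \<le> n" using n by simp
    have "e = {1, n - 1} \<or> (\<exists>i. e = {i, Suc i} \<and> 1 \<le> i \<and> Suc i < n)"
      using that unfolding wheel_rim_eq[OF n2] by blast
    then show ?thesis
    proof (elim disjE exE conjE)
      assume e: "e = {1, n - 1}"
      show ?thesis
      proof (cases "q = 1")
        case True
        then show ?thesis using e by (simp add: l_def insert_commute)
      next
        case False
        then have "pos 1 = n - q" "pos (n - 1) = n - 1 - q" using q by (auto simp: pos_def)
        then have "pos 1 = Suc (pos (n - 1))" using q by simp
        moreover have "e = {n - 1, 1}" using e by (simp add: insert_commute)
        ultimately show ?thesis using n by (intro disjI2 exI[of _ "n - 1"] exI[of _ 1]) simp
      qed
    next
      fix i assume i: "e = {i, Suc i}" "1 \<le> i" "Suc i < n"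
      show ?thesis
      proof (cases "Suc i = q")
        case True
        then show ?thesis using i by (auto simp: l_def)
      next
        case False
        then have "pos (Suc i) = Suc (pos i)" using q i by (auto simp: pos_def)
        then show ?thesis using i by (intro disjI2 exI[of _ i] exI[of _ "Suc i"]) simp
      qed
    qed
  qed
  have cases: thesis
    if x: "x \<in> verts (subdivide ?W ?F)"
      and 1: "\<And>v. x = Inl v \<Longrightarrow> 1 \<le> v \<Longrightarrow> v < n \<Longrightarrow> thesis"
      and 2: "x = Inl n \<Longrightarrow> thesis" and 3: "x = Inr {q, n} \<Longrightarrow> thesis"
      and 4: "x = Inr {l, q} \<Longrightarrow> thesis"
      and 5: "\<And>u v. x = Inr {u, v} \<Longrightarrow> 1 \<le> u \<Longrightarrow> u < n \<Longrightarrow> 1 \<le> v \<Longrightarrow> v < n \<Longrightarrow> pos v = Suc (pos u) \<Longrightarrow> thesis"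
    for x thesis
  proof (cases x)
    case (Inl v)
    with x have "1 \<le> v" "v \<le> n" by (auto simp: verts)
    then show ?thesis using 1[OF Inl] 2 Inl by (cases "v = n") auto
  next
    case (Inr e)
    with x have "e = {q, n} \<or> e \<in> wheel_rim n" by auto
    then show ?thesis
    proof
      assume "e = {q, n}"
      with Inr 3 show ?thesis by simp
    next
      assume "e \<in> wheel_rim n"
      from rim[OF this] show ?thesis
      proof (elim disjE exE conjE)
        assume "e = {l, q}"
        with Inr 4 show ?thesis by simp
      next
        fix u v assume "1 \<le> u" "u < n" "1 \<le> v" "v < n" "e = {u, v}" "pos v = Suc (pos u)"
        with Inr show ?thesis by (intro 5[of u v]) simp_all
      qed
    qed
  qed
  show "K24_minor_free (subdivide ?W ?F)"
  proof (rule K24_minor_free_embedding)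
    show "K24_minor_free ?D" using n by (intro K24_minor_free_double_fan) auto
    show "inj_on f (verts (subdivide ?W ?F))"
    proof (rule inj_on_inverseI)
      let ?i = "inv_into {1..<n} pos"
      fix x assume x: "x \<in> verts (subdivide ?W ?F)"
      have i: "?i (pos v) = v" if "1 \<le> v" "v < n" for v
        using that inj_pos by (intro inv_into_f_f) auto
      \<comment> \<open>An explicit inverse of \<open>f\<close>: the three top numbers are decoded
        separately, and below them parity tells rim vertices from vertices on rim edges.\<close>
      show "(\<lambda>m. if m = 2 * n - 1 then Inl n else if m = 2 * n - 2 then Inr {q, n}
          else if m = 2 * n - 3 then Inr {l, q} else if even m then Inl (?i (m div 2))
          else Inr {?i (m div 2), ?i (Suc (m div 2))}) (f x) = x"
      proof (rule cases[OF x])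
        fix v assume v: "x = Inl v" "1 \<le> v" "v < n"
        with pos_le[of v] n have "2 * pos v \<noteq> 2 * n - 1" "2 * pos v \<noteq> 2 * n - 2" "2 * pos v \<noteq> 2 * n - 3"
          by linarith+
        then show ?thesis using v i by (simp add: f_Inl)
      next
        assume "x = Inr {q, n}"
        moreover have "2 * n - 2 \<noteq> 2 * n - 1" using n by linarith
        ultimately show ?thesis by (simp add: f_spoke)
      next
        assume "x = Inr {l, q}"
        moreover have "2 * n - 3 \<noteq> 2 * n - 1" "2 * n - 3 \<noteq> 2 * n - 2" using n by linarith+
        ultimately show ?thesis by (simp add: f_last)
      next
        fix u v assume uv: "x = Inr {u, v}" "1 \<le> u" "u < n" "1 \<le> v" "v < n" "pos v = Suc (pos u)"
        with pos_le[of v] n have "Suc (2 * pos u) \<noteq> 2 * n - 1" "Suc (2 * pos u) \<noteq> 2 * n - 2"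
          "Suc (2 * pos u) \<noteq> 2 * n - 3"
          by linarith+
        moreover have "f x = Suc (2 * pos u)" using uv by (simp add: f_rim)
        moreover have "?i (Suc (pos u)) = v" using i[of v] uv by simp
        ultimately show ?thesis using uv i[of u] by simp
      qed (simp add: f_n)
    qed
    show "f ` verts (subdivide ?W ?F) \<subseteq> verts ?D"
    proof
      fix y assume "y \<in> f ` verts (subdivide ?W ?F)"
      then obtain x where x: "x \<in> verts (subdivide ?W ?F)" "y = f x" by blast
      have "f x \<le> 2 * n - 1"
      proof (rule cases[OF x(1)])
        fix v assume "x = Inl v" "1 \<le> v" "v < n"
        with pos_le[of v] show ?thesis by (simp add: f_Inl)
      next
        fix u v assume uv: "x = Inr {u, v}" "1 \<le> u" "u < n" "1 \<le> v" "v < n" "pos v = Suc (pos u)"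
        with pos_le[of v] show ?thesis by (simp add: f_rim)
      qed (simp_all add: f_n f_spoke f_last)
      with x show "y \<in> verts ?D" by simp
    qed
    have half: "adj ?D (f (Inl u)) (f (Inr e))" if e: "e \<in> ?F" "u \<in> e" for u e
    proof (rule cases[of "Inr e"])
      show "Inr e \<in> verts (subdivide ?W ?F)" using e by auto
    next
      assume "Inr e = (Inr {q, n} :: nat + nat set)"
      then have "e = {q, n}" by simp
      with e consider "u = q" | "u = n" by blast
      then show ?thesis
        using \<open>e = {q, n}\<close> n q
        by cases (simp_all add: f_Inl f_n f_spoke pos_q adj_double_fan fan_edge_def, linarith+)
    next
      assume "Inr e = (Inr {l, q} :: nat + nat set)"
      then have "e = {l, q}" by simp
      with e consider "u = q" | "u = l" by blast
      then show ?thesis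
        using \<open>e = {l, q}\<close> n q l
        by cases (simp_all add: f_Inl f_last pos_q adj_double_fan fan_edge_def, linarith+)
    next
      fix a b assume "Inr e = (Inr {a, b} :: nat + nat set)"
        and ab: "1 \<le> a" "a < n" "1 \<le> b" "b < n" "pos b = Suc (pos a)"
      then have e_ab: "e = {a, b}" by simp
      with e consider "u = a" | "u = b" by blast
      then show ?thesis
        using e_ab ab pos_le[of b] n
        by cases (simp_all add: f_Inl f_rim adj_double_fan fan_edge_def)
    qed simp_all
    have hub: "adj ?D (f (Inl x)) (f (Inl n))" if "1 \<le> x" "x < n" for x
    proof -
      have "2 * pos x < 2 * n - 1" "2 * pos x \<le> 2 * n - 3" using that n pos_le[of x] by linarith+
      then show ?thesis using that by (simp add: f_Inl f_n adj_double_fan fan_edge_def)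
    qed
    fix x y
    assume "x \<in> verts (subdivide ?W ?F)" "y \<in> verts (subdivide ?W ?F)"
      and xy: "adj (subdivide ?W ?F) x y"
    show "adj ?D (f x) (f y)"
    proof (cases x y rule: sum.exhaust[case_product sum.exhaust])
      case (Inl_Inl u v)
      \<comment> \<open>All rim edges are subdivided, so only spokes survive between old
        vertices.\<close>
      with xy have "adj ?W u v" "{u, v} \<notin> wheel_rim n" by simp_all
      then have "{u, v} \<in> edges ?W" "{u, v} \<notin> wheel_rim n" by (simp_all add: adj_def)
      then have "{u, v} \<in> (\<lambda>q. {q, n}) ` {1..n - 1}" unfolding edges by blast
      then obtain a where a: "a \<in> {1..n - 1}" "{u, v} = {a, n}" by (elim imageE)
      then have "adj ?D (f (Inl a)) (f (Inl n))" by (intro hub) auto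
      moreover have "u = a \<and> v = n \<or> u = n \<and> v = a" using a(2) unfolding doubleton_eq_iff by blast
      moreover have "adj ?D (f (Inl n)) (f (Inl a))" using calculation(1) by (simp only: adj_commute)
      ultimately show ?thesis unfolding Inl_Inl by (elim disjE conjE) simp_all
    next
      case (Inl_Inr u e)
      with xy half show ?thesis by simp
    next
      case (Inr_Inl e u)
      with xy half show ?thesis by (subst adj_commute) simp
    next
      case (Inr_Inr e e')
      with xy show ?thesis by simp
    qed
  qed
qed

lemma maximal_subdividable_wheel:
  assumes n: "6 \<le> n"
  shows "{F. maximal_subdividable (wheel n) F} = (\<lambda>q. insert {q, n} (wheel_rim n)) ` {1..n - 1}"
    and "card {F. maximal_subdividable (wheel n) F} = n - 1"
proof -
  \<comment> \<open>Rim edges avoid the hub, so different spokes give incomparable sets.\<close>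
  have not_rim: "{q, n} \<notin> wheel_rim n" if "q \<in> {1..n - 1}" for q
  proof -
    have "2 \<le> n" using n by simp
    moreover have "n \<notin> e" if "e \<in> wheel_rim n" for e
      using that n unfolding wheel_rim_eq[OF \<open>2 \<le> n\<close>] by auto
    ultimately show ?thesis by blast
  qed
  have inj: "x = y" if "x \<in> {1..n - 1}" "y \<in> {1..n - 1}"
    "insert {x, n} (wheel_rim n) \<subseteq> insert {y, n} (wheel_rim n)" for x y
  proof -
    have "{x, n} = {y, n}" using that not_rim[of x] by blast
    then show ?thesis using that by (auto simp: doubleton_eq_iff)
  qed
  show eq: "{F. maximal_subdividable (wheel n) F} = (\<lambda>q. insert {q, n} (wheel_rim n)) ` {1..n - 1}"
  proof (rule maximal_subdividable_eqI)
    show "subdividable (wheel n) S" if "S \<in> (\<lambda>q. insert {q, n} (wheel_rim n)) ` {1..n - 1}" for S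
    proof -
      from that obtain q where "S = insert {q, n} (wheel_rim n)" "q \<in> {1..n - 1}" by blast
      moreover from this have "1 \<le> q" "q < n" by auto
      ultimately show ?thesis using subdividable_rim_spoke[OF n] by simp
    qed
    show "S = T" if "S \<in> (\<lambda>q. insert {q, n} (wheel_rim n)) ` {1..n - 1}"
      "T \<in> (\<lambda>q. insert {q, n} (wheel_rim n)) ` {1..n - 1}" "S \<subseteq> T" for S T
    proof -
      from that(1,2) obtain x y where "x \<in> {1..n - 1}" "S = insert {x, n} (wheel_rim n)"
        "y \<in> {1..n - 1}" "T = insert {y, n} (wheel_rim n)" by blast
      with inj[of x y] that(3) show ?thesis by simp
    qed
    fix F assume F: "subdividable (wheel n) F"
    then have sub: "F \<subseteq> wheel_rim n \<union> (\<lambda>q. {q, n}) ` {1..n - 1}"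
      unfolding subdividable_def edges_wheel[OF n] by simp
    have "\<exists>q\<in>{1..n - 1}. F \<subseteq> insert {q, n} (wheel_rim n)"
    proof (cases "\<exists>q\<in>{1..n - 1}. {q, n} \<in> F")
      case True
      then obtain q where q: "q \<in> {1..n - 1}" "{q, n} \<in> F" by blast
      have "x = q" if "x \<in> {1..n - 1}" "{x, n} \<in> F" for x
      proof (rule ccontr)
        assume "x \<noteq> q"
        then consider "x < q" | "q < x" by linarith
        then show False
          by cases (use not_subdividable_spokes[OF n] q that F in auto)
      qed
      then have "F \<subseteq> insert {q, n} (wheel_rim n)" using sub by auto
      with q show ?thesis by blast
    next
      case False
      then have "F \<subseteq> insert {1, n} (wheel_rim n)" using sub by auto
      moreover have "1 \<in> {1..n - 1}" using n by simp
      ultimately show ?thesis by blast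
    qed
    then show "\<exists>S\<in>(\<lambda>q. insert {q, n} (wheel_rim n)) ` {1..n - 1}. F \<subseteq> S" by blast
  qed
  have "inj_on (\<lambda>q. insert {q, n} (wheel_rim n)) {1..n - 1}"
    by (rule inj_onI, rule inj) simp_all
  then show "card {F. maximal_subdividable (wheel n) F} = n - 1"
    unfolding eq by (simp add: card_image)
qed

theorem theorem3p6:
  fixes n r s :: nat and G :: "nat graph"
  assumes "6 \<le> n" and "r \<in> {0..n-3}" and "s \<in> {0..n-3}" and "r \<le> s"
    and "G = G_graph n r s \<or> G = Gplus_graph n r s"
    and "G \<in> G_class"
  shows "(r = 1 \<longrightarrow>
            G = wheel n \<and>
            card {F. maximal_subdividable (wheel n) F} = n - 1 \<and>
            (\<forall>F. maximal_subdividable (wheel n) F \<longrightarrow>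
               (\<exists>e \<in> wheel_spokes n. F = wheel_rim n \<union> {e}))) \<and>
         (r = 2 \<and> (G = G_graph n 2 s \<and> 4 \<le> s \<or> G = Gplus_graph n 2 s \<and> 3 \<le> s) \<longrightarrow>
            {F. maximal_subdividable G F} =
              {spine n, walk_edges (rev [1..<n-1] @ [n-1, n])} \<and>
            spine n \<noteq> walk_edges (rev [1..<n-1] @ [n-1, n])) \<and>
         (3 \<le> r \<longrightarrow> {F. maximal_subdividable G F} = {spine n})"
proof (intro conjI impI)
  have conn_free: "k_connected 3 G" "K24_minor_free G" using assms(6) by (auto simp: G_class_def)
  define p where "p \<longleftrightarrow> G = Gplus_graph n r s"
  interpret spine_graph p n r s G
    using assms(1-3,5) by unfold_locales (auto simp only: p_def atLeastAtMost_iff split: if_split)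
  show "G = wheel n" if "r = 1"
    using conn_free(1) that assms(4) by (rule r_1_imp_wheel)
  show "card {F. maximal_subdividable (wheel n) F} = n - 1"
    by (rule maximal_subdividable_wheel(2)[OF n])
  show "\<forall>F. maximal_subdividable (wheel n) F \<longrightarrow> (\<exists>e \<in> wheel_spokes n. F = wheel_rim n \<union> {e})"
  proof (intro allI impI)
    fix F assume "maximal_subdividable (wheel n) F"
    then have "F \<in> (\<lambda>q. insert {q, n} (wheel_rim n)) ` {1..n - 1}"
      unfolding maximal_subdividable_wheel(1)[OF n, symmetric] by simp
    then obtain q where q: "q \<in> {1..n - 1}" "F = insert {q, n} (wheel_rim n)" by (elim imageE)
    then have "{q, n} \<in> wheel_spokes n"
      by (simp add: wheel_spokes_def edges_wheel[OF n])
    moreover have "F = wheel_rim n \<union> {{q, n}}" using q(2) by simp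
    ultimately show "\<exists>e \<in> wheel_spokes n. F = wheel_rim n \<union> {e}" by (rule bexI[rotated])
  qed
  show "{F. maximal_subdividable G F} = {spine n}" if "3 \<le> r"
    using maximal_subdividable_r_ge_3[OF that assms(4) r_plus_s[OF conn_free(2) assms(4)]] .
  assume r2: "r = 2 \<and> (G = G_graph n 2 s \<and> 4 \<le> s \<or> G = Gplus_graph n 2 s \<and> 3 \<le> s)"
  show "spine n \<noteq> walk_edges (rev [1..<n-1] @ [n-1, n])"
    using spine_second_path_incomparable(1) unfolding second_path_def by (metis order_refl)
  show "{F. maximal_subdividable G F} = {spine n, walk_edges (rev [1..<n-1] @ [n-1, n])}"
  proof (cases "4 \<le> s")
    case True
    with r2 maximal_subdividable_r_2 show ?thesis by (simp add: second_path_def)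
  next
    case False
    \<comment> \<open>Now \<open>s = 3\<close>, so v_1 v_n is an edge, and the locale is entered
      again with its flag fixed to \<open>True\<close>.\<close>
    with r2 have "3 \<le> s" and G': "G = Gplus_graph n r s" by simp_all
    interpret plus: spine_graph True n r s G
      using n r s G' by unfold_locales simp_all
    have "r = 2" using r2 by simp
    from plus.maximal_subdividable_r_2[OF this \<open>3 \<le> s\<close>] show ?thesis
      by (simp add: second_path_def)
  qed
qed

end
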